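(* Let $n,d,c\in\mathbb{N}$ with $d\ge 50$ and $1\le c\le d$. For every hereditary family $\mathcal{F}\subseteq 2^{[n]}$ with $\delta(\mathcal{F})\ge 2^{d-1}-c+1$, we have $\sum_{x\in[n]}\omega_{\mathcal{F}}(x)\ge \mathfrak{B}_c\, n$.
   Context: A family $\mathcal{F}\subseteq 2^{[n]}$ is hereditary if $F'\subseteq F\in\mathcal{F}$ implies $F'\in\mathcal{F}$. $d_{\mathcal{F}}(x)=|\{F\in\mathcal{F}:x\in F\}|$ and $\delta(\mathcal{F})=\min_{x\in[n]}d_{\mathcal{F}}(x)$. The weight of $x$ is $\omega_{\mathcal{F}}(x)=\sum_{x\in F\in\mathcal{F}}\frac{1}{|F|}$. For $1\le c\le d$, $\mathfrak{B}_c=\frac{2^d-c}{d}$ if $1\le c\le d-1$ and $\mathfrak{B}_d=\frac{2^d-d-\frac12}{d}$. *)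

theory Defs
  imports Main "HOL.Real"
begin

definition hereditary :: "'a set set \<Rightarrow> bool" where
  "hereditary F \<longleftrightarrow> (\<forall>G H. G \<subseteq> H \<longrightarrow> H \<in> F \<longrightarrow> G \<in> F)"

definition deg :: "'a set set \<Rightarrow> 'a \<Rightarrow> nat" where
  "deg F x = card {A \<in> F. x \<in> A}"

definition min_deg :: "nat set set \<Rightarrow> nat \<Rightarrow> nat" where
  "min_deg F n = Min ((deg F) ` {1..n})"

definition weight :: "'a set set \<Rightarrow> 'a \<Rightarrow> real" where
  "weight F x = (\<Sum>A \<in> {A \<in> F. x \<in> A}. 1 / real (card A))"

definition frakB :: "nat \<Rightarrow> nat \<Rightarrow> real" where
  "frakB d c = (if c = d then (2 ^ d - real d - 1/2) / real d
               else (2 ^ d - real c) / real d)"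

end

(* Let N = 2^(d-2), let s(i) be the binary digit sum of i, and let G(h, m) be the sum of h(s(i)) over
   i < m. For decreasing h, a hereditary family of m sets has total h-weight at least G(h, m), because
   G(h, a + b) <= G(h, a) + G(h(. + 1), b) for b <= a.

   A vertex x has at least d - 1 neighbours. If it has more, averaging yields a vertex v of its link
   that is missed by more than N sets of the link. Splitting the link at v and using the symmetry of
   the digit sums under complementation shows that the weight of x is at least (2^d - c)/d.

   Otherwise x and its neighbours form a block D with d points. Let C be the hereditary family of the
   complements in D of the subsets of D that are not in F. A vertex v of D lies in at least
   |C| - (c - 1) - deg_C(v) members of F that leave D, and sum_v deg_C(v) is small, being at most the
   sum of the first |C| digit sums; so the weight of the sets leaving D compensates for the excess of
   |C| over c - 1. A vertex in several blocks has exponentially large excess weight, so when every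
   vertex shares its excess equally among its blocks, each block still receives a nonnegative total. *)
theory Submission
  imports Defs
begin

section \<open>Sums over initial segments of the colexicographic order\<close>

fun digit_sum :: "nat \<Rightarrow> nat" where
  "digit_sum n = (if n = 0 then 0 else n mod 2 + digit_sum (n div 2))"

declare digit_sum.simps [simp del]

lemma digit_sum_0 [simp]: "digit_sum 0 = 0"
  by (simp add: digit_sum.simps)

lemma digit_sum_double [simp]: "digit_sum (2 * n) = digit_sum n"
  by (cases "n = 0") (simp_all add: digit_sum.simps [of "2 * n"])

lemma digit_sum_Suc_double [simp]: "digit_sum (Suc (2 * n)) = Suc (digit_sum n)"
  by (simp add: digit_sum.simps [of "Suc (2 * n)"])

lemma digit_sum_le:
  "j < 2 ^ k \<Longrightarrow> digit_sum j \<le> k"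
proof (induction k arbitrary: j)
  case 0
  then show ?case by simp
next
  case (Suc k)
  have "digit_sum (j div 2) \<le> k" using Suc by simp
  then show ?case
    by (cases "even j") (auto elim!: evenE oddE)
qed

lemma digit_sum_add_power:
  "j < 2 ^ k \<Longrightarrow> digit_sum (2 ^ k + j) = Suc (digit_sum j)"
proof (induction k arbitrary: j)
  case 0
  then show ?case using digit_sum_Suc_double [of 0] by simp
next
  case (Suc k)
  have IH: "digit_sum (2 ^ k + j div 2) = Suc (digit_sum (j div 2))"
    using Suc by simp
  show ?case
  proof (cases "even j")
    case True
    then obtain i where "j = 2 * i" by blast
    with IH show ?thesis using digit_sum_double [of "2 ^ k + i"] by (simp add: distrib_left del: digit_sum_double) simp
  next
    case False
    then obtain i where "j = Suc (2 * i)" by (auto elim: oddE)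
    with IH show ?thesis using digit_sum_Suc_double [of "2 ^ k + i"] by (simp add: distrib_left)
  qed
qed

text \<open>\<open>2 ^ k - Suc j\<close> arises from \<open>j\<close> by flipping its
  \<open>k\<close> lowest binary digits.\<close>

lemma digit_sum_complement:
  "j < 2 ^ k \<Longrightarrow> digit_sum (2 ^ k - Suc j) + digit_sum j = k"
proof (induction k arbitrary: j)
  case 0
  then show ?case by simp
next
  case (Suc k)
  have lt: "j div 2 < 2 ^ k" using Suc.prems by simp
  have IH: "digit_sum (2 ^ k - Suc (j div 2)) + digit_sum (j div 2) = k"
    using Suc.IH [OF lt] .
  show ?case
  proof (cases "even j")
    case True
    then obtain i where i: "j = 2 * i" by blast
    have "2 ^ Suc k - Suc j = Suc (2 * (2 ^ k - Suc i))"
      using lt i by simp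
    with IH i show ?thesis by simp
  next
    case False
    then obtain i where i: "j = Suc (2 * i)" by (auto elim: oddE)
    have "2 ^ Suc k - Suc j = 2 * (2 ^ k - Suc i)"
      using lt i by simp
    with IH i show ?thesis by simp
  qed
qed

text \<open>If \<open>i\<close> codes the set of positions of its binary ones, then
  \<open>digit_sum i\<close> is the size of that set, and the codes below \<open>m\<close> form the
  initial segment of length \<open>m\<close> of the colexicographic order. The sum is therefore the
  total \<open>h\<close>-weight of this hereditary family.\<close>

definition colex_sum :: "(nat \<Rightarrow> real) \<Rightarrow> nat \<Rightarrow> real" where
  "colex_sum h m = (\<Sum>i<m. h (digit_sum i))"

lemma colex_sum_0 [simp]: "colex_sum h 0 = 0"
  by (simp add: colex_sum_def)

lemma colex_sum_Suc: "colex_sum h (Suc m) = colex_sum h m + h (digit_sum m)"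
  by (simp add: colex_sum_def)

lemma colex_sum_1: "colex_sum h (Suc 0) = h 0"
  by (simp add: colex_sum_Suc)

lemma colex_sum_double:
  "colex_sum h (2 * m) = colex_sum h m + colex_sum (h \<circ> Suc) m"
  by (induction m) (simp_all add: colex_sum_Suc)

lemma colex_sum_Suc_double:
  "colex_sum h (Suc (2 * m)) = colex_sum h (Suc m) + colex_sum (h \<circ> Suc) m"
  by (simp add: colex_sum_double colex_sum_Suc)

lemma colex_sum_mono:
  assumes "\<And>i. h i \<ge> 0" "m \<le> n"
  shows "colex_sum h m \<le> colex_sum h n"
  unfolding colex_sum_def using assms by (intro sum_mono2) auto

lemma antimono_comp_Suc: "antimono h \<Longrightarrow> antimono (h \<circ> Suc)"
  by (auto simp: antimono_def)

text \<open>Appending a binary digit 0 keeps the digit sum and appending 1 raises it by one, so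
  halving \<open>a\<close> and \<open>b\<close> reduces the claim to one instance for
  \<open>h\<close> and one for \<open>h \<circ> Suc\<close>. Monotonicity of \<open>h\<close> is
  used directly only when both are odd, where one term at \<open>q\<close> remains on each side. The
  cases \<open>b = 0\<close> and \<open>a = b\<close> are separate so that the halved instances are
  smaller and still ordered.\<close>

lemma colex_sum_split:
  assumes "antimono h" "b \<le> a"
  shows "colex_sum h (a + b) \<le> colex_sum h a + colex_sum (h \<circ> Suc) b"
  using assms
proof (induction "a + b" arbitrary: a b h rule: less_induct)
  case less
  have h': "antimono (h \<circ> Suc)" using less.prems(1) by (rule antimono_comp_Suc)
  consider "b = 0" | "a = b" | "0 < b" "b < a" using less.prems(2) by linarith
  then show ?case
  proof cases
    case 1
    then show ?thesis by simp
  next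
    case 2
    then show ?thesis using colex_sum_double [of h a] by (simp add: mult_2)
  next
    case 3
    note IH = less.hyps [OF _ less.prems(1)] and IH' = less.hyps [OF _ h']
    show ?thesis
    proof (cases "even a"; cases "even b")
      assume "even a" "even b"
      then obtain p q where p: "a = 2 * p" and q: "b = 2 * q" by (auto elim!: evenE)
      then have s: "a + b = 2 * (p + q)" by simp
      have "colex_sum h (p + q) \<le> colex_sum h p + colex_sum (h \<circ> Suc) q"
        by (rule IH) (use 3 p q in auto)
      moreover have "colex_sum (h \<circ> Suc) (p + q) \<le> colex_sum (h \<circ> Suc) p + colex_sum (h \<circ> Suc \<circ> Suc) q"
        by (rule IH') (use 3 p q in auto)
      ultimately show ?thesis unfolding s unfolding p q colex_sum_double by simp
    next
      assume "even a" "odd b"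
      then obtain p q where p: "a = 2 * p" and q: "b = Suc (2 * q)" by (auto elim!: evenE oddE)
      then have s: "a + b = Suc (2 * (p + q))" by simp
      have "colex_sum h (p + Suc q) \<le> colex_sum h p + colex_sum (h \<circ> Suc) (Suc q)"
        by (rule IH) (use 3 p q in auto)
      moreover have "colex_sum (h \<circ> Suc) (p + q) \<le> colex_sum (h \<circ> Suc) p + colex_sum (h \<circ> Suc \<circ> Suc) q"
        by (rule IH') (use 3 p q in auto)
      ultimately show ?thesis unfolding s unfolding p q colex_sum_double colex_sum_Suc_double by simp
    next
      assume "odd a" "even b"
      then obtain p q where p: "a = Suc (2 * p)" and q: "b = 2 * q" by (auto elim!: evenE oddE)
      then have s: "a + b = Suc (2 * (p + q))" by simp
      have "colex_sum h (Suc p + q) \<le> colex_sum h (Suc p) + colex_sum (h \<circ> Suc) q"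
        by (rule IH) (use 3 p q in auto)
      moreover have "colex_sum (h \<circ> Suc) (p + q) \<le> colex_sum (h \<circ> Suc) p + colex_sum (h \<circ> Suc \<circ> Suc) q"
        by (rule IH') (use 3 p q in auto)
      ultimately show ?thesis unfolding s unfolding p q colex_sum_double colex_sum_Suc_double by simp
    next
      assume "odd a" "odd b"
      then obtain p q where p: "a = Suc (2 * p)" and q: "b = Suc (2 * q)" by (auto elim!: oddE)
      then have s: "a + b = 2 * (Suc (p + q))" by simp
      have "colex_sum h (Suc p + q) \<le> colex_sum h (Suc p) + colex_sum (h \<circ> Suc) q"
        by (rule IH) (use 3 p q in auto)
      moreover have "colex_sum (h \<circ> Suc) (p + Suc q) \<le> colex_sum (h \<circ> Suc) p + colex_sum (h \<circ> Suc \<circ> Suc) (Suc q)"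
        by (rule IH') (use 3 p q in auto)
      moreover have "h (Suc (Suc (digit_sum q))) \<le> h (Suc (digit_sum q))"
        using less.prems(1) by (simp add: antimono_def)
      ultimately show ?thesis
        unfolding s unfolding p q colex_sum_double colex_sum_Suc_double by (simp add: colex_sum_Suc)
    qed
  qed
qed

lemma colex_sum_subadditive:
  assumes "antimono h"
  shows "colex_sum h (a + b) \<le> colex_sum h a + colex_sum h b"
proof -
  have le: "colex_sum (h \<circ> Suc) m \<le> colex_sum h m" for m
    unfolding colex_sum_def using assms by (intro sum_mono) (auto simp: antimono_def)
  show ?thesis
  proof (cases "b \<le> a")
    case True
    then show ?thesis using colex_sum_split [OF assms True] le [of b] by linarith
  next
    case False
    then show ?thesis using colex_sum_split [OF assms, of a b] le [of a] by (simp add: add.commute)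
  qed
qed

lemma colex_sum_power_add:
  "j \<le> 2 ^ k \<Longrightarrow> colex_sum h (2 ^ k + j) = colex_sum h (2 ^ k) + colex_sum (h \<circ> Suc) j"
proof (induction j)
  case (Suc j)
  then show ?case by (simp add: colex_sum_Suc digit_sum_add_power)
qed simp

text \<open>The \<open>j\<close> largest codes below \<open>2 ^ k\<close> are the complements of the
  \<open>j\<close> smallest ones.\<close>

lemma colex_sum_complement:
  "j \<le> 2 ^ k \<Longrightarrow> colex_sum h (2 ^ k - j) + colex_sum (\<lambda>i. h (k - i)) j = colex_sum h (2 ^ k)"
proof (induction j)
  case (Suc j)
  have "2 ^ k - j = Suc (2 ^ k - Suc j)" using Suc.prems by simp
  moreover have "digit_sum (2 ^ k - Suc j) = k - digit_sum j"
    using digit_sum_complement [of j k] Suc.prems by simp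
  ultimately show ?case using Suc by (simp add: colex_sum_Suc)
qed simp

lemma colex_sum_power:
  "colex_sum h (2 ^ k) = (\<Sum>i\<le>k. real (k choose i) * h i)"
proof (induction k arbitrary: h)
  case 0
  show ?case by (simp add: colex_sum_def)
next
  case (Suc k)
  have "colex_sum h (2 ^ Suc k) = (\<Sum>i\<le>k. real (k choose i) * h i) + (\<Sum>i\<le>k. real (k choose i) * h (Suc i))"
    using colex_sum_double [of h "2 ^ k"] Suc by simp
  also have "(\<Sum>i\<le>k. real (k choose i) * h i) = (\<Sum>i\<le>Suc k. real (k choose i) * h i)"
    by simp
  also have "\<dots> = h 0 + (\<Sum>i\<le>k. real (k choose Suc i) * h (Suc i))"
    by (simp only: sum.atMost_Suc_shift) simp
  finally show ?case
    by (simp only: sum.atMost_Suc_shift) (simp add: sum.distrib algebra_simps)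
qed

text \<open>This is the weight of a point in the full power set of \<open>Suc k\<close> points. The
  absorption identity turns each summand into a binomial coefficient over
  \<open>Suc k\<close>.\<close>

lemma colex_sum_inverse_power:
  "colex_sum (\<lambda>i. 1 / real (Suc i)) (2 ^ k) = (2 ^ Suc k - 1) / real (Suc k)"
proof -
  have *: "real (k choose i) * (1 / real (Suc i)) = real (Suc k choose Suc i) / real (Suc k)" for i
  proof -
    have "real (Suc i) * real (Suc k choose Suc i) = real (Suc k) * real (k choose i)"
      using Suc_times_binomial_eq [of k i] by (metis mult.commute of_nat_mult)
    then show ?thesis by (simp add: field_simps del: binomial_Suc_Suc of_nat_Suc)
  qed
  have "(\<Sum>i\<le>Suc k. real (Suc k choose i)) = 2 ^ Suc k"
    using choose_row_sum [of "Suc k"] by (metis of_nat_numeral of_nat_power of_nat_sum)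
  then have "(\<Sum>i\<le>k. real (Suc k choose Suc i)) = 2 ^ Suc k - 1"
    by (simp only: sum.atMost_Suc_shift) simp
  then show ?thesis
    unfolding colex_sum_power * by (simp add: sum_divide_distrib [symmetric] del: binomial_Suc_Suc of_nat_Suc)
qed

section \<open>A quadratic bound on sums of digit sums\<close>

lemma colex_sum_real_Suc_comp: "colex_sum (real \<circ> Suc) q = colex_sum real q + real q"
  by (simp add: colex_sum_def sum.distrib)

text \<open>With the next rule, \<open>simp\<close> evaluates the sum at a numeral by recursion on
  its binary representation.\<close>

lemma colex_sum_real_Bit0:
  "colex_sum real (numeral (num.Bit0 q)) = 2 * colex_sum real (numeral q) + numeral q"
proof -
  have "numeral (num.Bit0 q) = 2 * (numeral q :: nat)" by simp
  then show ?thesis by (simp only: colex_sum_double colex_sum_real_Suc_comp) simp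
qed

lemma colex_sum_real_Bit1:
  "colex_sum real (numeral (num.Bit1 q))
    = colex_sum real (numeral (q + num.One)) + colex_sum real (numeral q) + numeral q"
proof -
  have "numeral (num.Bit1 q) = Suc (2 * (numeral q :: nat))" by simp
  then show ?thesis by (simp only: colex_sum_Suc_double colex_sum_real_Suc_comp Suc_numeral) simp
qed

text \<open>Base cases for the next lemma, whose halving step absorbs an extra
  \<open>256 * q\<close> by means of \<open>43 * q <= q * q\<close>; hence the limit
  \<open>86 = 2 * 43\<close>.\<close>

lemma sum_digit_sum_bound_small:
  "list_all (\<lambda>m. 256 * colex_sum real m \<le> real m * (576 + 3 * real m)) [2..<86]"
  by (simp add: upt_rec_numeral colex_sum_real_Bit0 colex_sum_real_Bit1 colex_sum_1 del: set_upt)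

text \<open>The true order of growth is \<open>m log m\<close>; a quadratic majorant keeps the later
  comparison in \<open>block_numeric\<close> polynomial. The constants make the bound an equality at
  \<open>m = 64\<close>.\<close>

lemma sum_digit_sum_bound:
  "256 * colex_sum real m \<le> real m * (576 + 3 * real m)"
proof (induction m rule: less_induct)
  case (less m)
  show ?case
  proof (cases "m < 86")
    case m86: True
    show ?thesis
    proof (cases "m < 2")
      case True
      then show ?thesis by (auto simp: less_2_cases_iff colex_sum_1)
    next
      case False
      then have "2 \<le> m \<and> m < 86" using m86 by simp
      then have "m \<in> set [2..<86]" by (simp only: set_upt atLeastLessThan_iff)
      then show ?thesis using sum_digit_sum_bound_small unfolding list_all_iff by blast
    qed
  next
    case False
    show ?thesis
    proof (cases "even m")
      case True
      then obtain q where q: "m = 2 * q" by blast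
      have q43: "real q \<ge> 43" using q False by simp
      have "256 * colex_sum real q \<le> real q * (576 + 3 * real q)"
        using less.IH [of q] q False by simp
      moreover have "colex_sum real m = 2 * colex_sum real q + real q"
        by (simp add: q colex_sum_double colex_sum_real_Suc_comp)
      moreover have "43 * real q \<le> real q * real q" using q43 by (intro mult_right_mono) auto
      ultimately show ?thesis by (simp add: q algebra_simps)
    next
      case odd: False
      then obtain q where q: "m = Suc (2 * q)" by (auto elim: oddE)
      have "q \<ge> 43" using q False by simp
      then have q43: "real q \<ge> 43" by simp
      have "256 * colex_sum real q \<le> real q * (576 + 3 * real q)"
        using less.IH [of q] q False by simp
      moreover have "256 * colex_sum real (Suc q) \<le> real (Suc q) * (576 + 3 * real (Suc q))"
        using less.IH [of "Suc q"] q False by simp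
      moreover have "colex_sum real m = colex_sum real (Suc q) + colex_sum real q + real q"
        by (simp add: q colex_sum_Suc_double colex_sum_real_Suc_comp)
      moreover have "43 * real q \<le> real q * real q" using q43 by (intro mult_right_mono) auto
      ultimately show ?thesis by (simp add: q algebra_simps)
    qed
  qed
qed

text \<open>Induction on \<open>k\<close>: reflection reduces to the first half of the cube, where the part of \<open>g\<close> that is
  antisymmetric about \<open>(k - 1) / 2\<close> again satisfies the assumptions and the rest is at least \<open>e\<close>.\<close>
lemma colex_sum_antisymmetric:
  assumes "\<And>i. i \<le> k \<Longrightarrow> g (k - i) = - g i"
    and "\<And>i. i < k \<Longrightarrow> g (Suc i) + 2 * e \<le> g i" and "e \<ge> 0" and "r \<le> 2 ^ k"
  shows "0 \<le> colex_sum g r" and "2 * r \<le> 2 ^ k \<Longrightarrow> 0 < k \<Longrightarrow> e * real r \<le> colex_sum g r"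
proof -
  have main: "0 \<le> colex_sum g r \<and> (2 * r \<le> 2 ^ k \<longrightarrow> 0 < k \<longrightarrow> e * real r \<le> colex_sum g r)"
    using assms
  proof (induction k arbitrary: g r)
    case 0
    have "g 0 = 0" using 0(1) [of 0] by simp
    then have "colex_sum g r = 0" using 0(4) by (cases r) (auto simp: colex_sum_Suc)
    then show ?case by simp
  next
    case (Suc k)
    have low: "e * real r \<le> colex_sum g r" if r: "2 * r \<le> 2 ^ Suc k" for r
    proof -
      define g' where "g' i = (g i - g (k - i)) / 2" for i
      have "0 \<le> colex_sum g' r"
      proof (rule conjunct1 [OF Suc.IH])
        show "g' (k - i) = - g' i" if "i \<le> k" for i
          using that by (simp add: g'_def field_simps)
        show "g' (Suc i) + 2 * e \<le> g' i" if "i < k" for i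
        proof -
          have "g (Suc i) + 2 * e \<le> g i" using that Suc.prems(2) by simp
          moreover have "g (k - i) + 2 * e \<le> g (k - Suc i)"
            using that Suc.prems(2) [of "k - Suc i"] by (simp add: Suc_diff_Suc)
          ultimately show ?thesis by (simp add: g'_def field_simps)
        qed
      qed (use r Suc.prems in auto)
      moreover have "g' (digit_sum j) + e \<le> g (digit_sum j)" if "j < r" for j
      proof -
        have le: "digit_sum j \<le> k" using digit_sum_le [of j k] that r by simp
        \<comment> \<open>The removed part is \<open>g i - g' i = (g i + g (k - i)) / 2\<close>.
          Antisymmetry of \<open>g\<close> with respect to \<open>Suc k\<close> makes it
          \<open>(g i - g (Suc i)) / 2\<close>, which is at least \<open>e\<close>.\<close>
        have "g (Suc (digit_sum j)) + 2 * e \<le> g (digit_sum j)" using Suc.prems(2) le by simp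
        moreover have "g (k - digit_sum j) = - g (Suc (digit_sum j))"
          using Suc.prems(1) [of "Suc (digit_sum j)"] le by simp
        ultimately show ?thesis by (simp add: g'_def field_simps)
      qed
      then have "colex_sum g' r + e * real r \<le> colex_sum g r"
        unfolding colex_sum_def using sum_mono [of "{..<r}" "\<lambda>j. g' (digit_sum j) + e"]
        by (simp add: sum.distrib mult.commute)
      ultimately show ?thesis by simp
    qed
    \<comment> \<open>By antisymmetry the sum over the whole cube vanishes, so the upper half of the
      range of \<open>r\<close> mirrors the lower half.\<close>
    have refl: "colex_sum g r = colex_sum g (2 ^ Suc k - r)" if "r \<le> 2 ^ Suc k" for r
    proof -
      have neg: "colex_sum (\<lambda>i. g (Suc k - i)) j = - colex_sum g j" if "j \<le> 2 ^ Suc k" for j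
        unfolding colex_sum_def sum_negf [symmetric]
        using that by (intro sum.cong refl Suc.prems(1) digit_sum_le) auto
      have "colex_sum g (2 ^ Suc k) = 0"
        using colex_sum_complement [of "2 ^ Suc k" "Suc k" g] neg [of "2 ^ Suc k"] by simp
      then show ?thesis
        using colex_sum_complement [OF that, of g] neg [OF that] by simp
    qed
    have "0 \<le> colex_sum g r"
    proof (cases "2 * r \<le> 2 ^ Suc k")
      case True
      have "0 \<le> e * real r" using Suc.prems(3) by simp
      then show ?thesis using low [OF True] by linarith
    next
      case False
      have "0 \<le> e * real (2 ^ Suc k - r)" using Suc.prems(3) by simp
      then show ?thesis using low [of "2 ^ Suc k - r"] refl [OF Suc.prems(4)] False by linarith
    qed
    then show ?case using low by blast
  qed
  then show "0 \<le> colex_sum g r" and "2 * r \<le> 2 ^ k \<Longrightarrow> 0 < k \<Longrightarrow> e * real r \<le> colex_sum g r" by auto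
qed

text \<open>For \<open>d <= 3 * l + 4\<close> the two summands dominate
  \<open>(d + 2)^2 * (d - 1)\<close> and \<open>4 * d\<close>, the quantities that have to be
  compared with \<open>2 ^ l\<close> below.\<close>

lemma cube_le_power_two:
  "16 \<le> l \<Longrightarrow> (3 * l + 6)^2 * (3 * l + 3) + 4 * (3 * l + 4) \<le> 4 * (2::nat) ^ l"
proof (induction l rule: dec_induct)
  case (step l)
  obtain x where x: "l = 16 + x" using step.hyps(1) by (metis le_Suc_ex)
  have "(3 * Suc l + 6)^2 * (3 * Suc l + 3) + 4 * (3 * Suc l + 4)
      \<le> 2 * ((3 * l + 6)^2 * (3 * l + 3) + 4 * (3 * l + 4))"
    by (simp add: x power2_eq_square algebra_simps)
  with step.IH show ?case by simp
qed simp

lemma cubic_le_power_two: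
  "50 \<le> d \<Longrightarrow> 2 * d ^ 3 + 3 * d ^ 2 \<le> (2::nat) ^ (d - 3)"
proof (induction d rule: dec_induct)
  case (step d)
  obtain x where x: "d = 50 + x" using step.hyps(1) by (metis le_Suc_ex)
  have "2 * Suc d ^ 3 + 3 * Suc d ^ 2 \<le> 2 * (2 * d ^ 3 + 3 * d ^ 2)"
    by (simp add: x power2_eq_square power3_eq_cube algebra_simps)
  also have "\<dots> \<le> 2 * 2 ^ (d - 3)" using step.IH by simp
  also have "\<dots> = 2 ^ (Suc d - 3)"
  proof -
    have "Suc d - 3 = Suc (d - 3)" using step.hyps(1) by linarith
    then show ?thesis by (simp only: power_Suc)
  qed
  finally show ?case .
qed simp

text \<open>A member \<open>B\<close> of the link of \<open>x\<close> stands for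
  \<open>insert x B\<close>, whose share in the weight of \<open>x\<close> is
  \<open>inv_Suc (card B)\<close>.\<close>

abbreviation inv_Suc :: "nat \<Rightarrow> real" where
  "inv_Suc \<equiv> \<lambda>i. 1 / real (Suc i)"

lemma antimono_inv_Suc: "antimono inv_Suc"
  by (rule antimonoI) (auto intro!: divide_left_mono)

lemma colex_sum_inv_Suc_cube:
  assumes "d \<ge> 2"
  shows "colex_sum inv_Suc (2 ^ (d - 2)) + colex_sum (inv_Suc \<circ> Suc) (2 ^ (d - 2)) = (2 ^ d - 1) / real d"
proof -
  obtain k where "d = Suc (Suc k)" using assms by (metis add_2_eq_Suc le_Suc_ex)
  then show ?thesis
    using colex_sum_inverse_power [of "Suc k"] colex_sum_double [of inv_Suc "2 ^ k"] by simp
qed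

text \<open>The two differences are \<open>1 / P\<close> and \<open>1 / Q\<close>, their sum is at
  least \<open>4 / (P + Q)\<close>, and \<open>P + Q <= (p + q)^2\<close>. The bound depends on
  \<open>p + q\<close> only, which makes it uniform along the function \<open>g\<close>
  below.\<close>

lemma inverse_products_lower_bound:
  fixes p q :: real
  assumes "p \<ge> 1" "q > 1"
  shows "4 / (p + q)^2 \<le> 1 / p - 1 / (p + 1) + (1 / (q - 1) - 1 / q)"
proof -
  define P Q where "P = p * (p + 1)" and "Q = q * (q - 1)"
  have pos: "P > 0" "Q > 0" using assms by (auto simp: P_def Q_def)
  have "P + Q \<le> (p + q)^2"
  proof -
    have "p * 1 \<le> p * q" using assms by (intro mult_left_mono) auto
    moreover have "0 \<le> p * q" using assms by simp
    moreover have "(p + q)^2 = P + Q + 2 * (p * q) - p + q"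
      by (simp add: P_def Q_def power2_eq_square algebra_simps)
    ultimately show ?thesis using assms by linarith
  qed
  then have "4 / (p + q)^2 \<le> 4 / (P + Q)" using pos by (intro divide_left_mono mult_pos_pos) auto
  also have "\<dots> \<le> 1 / P + 1 / Q"
  proof -
    have "4 * (P * Q) \<le> (P + Q) * (P + Q)"
      using zero_le_square [of "P - Q"] by (simp add: algebra_simps)
    then show ?thesis using pos by (simp add: divide_simps) (simp add: algebra_simps)
  qed
  also have "\<dots> = 1 / p - 1 / (p + 1) + (1 / (q - 1) - 1 / q)"
    using assms by (simp add: P_def Q_def divide_simps)
  finally show ?thesis .
qed

text \<open>The full cube, with a single segment of length \<open>N = 2 ^ (d - 2)\<close> in the
  second place, has sum \<open>(2 ^ d - 1) / d\<close>. Two segments with \<open>c - 1\<close> codes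
  fewer must lose at most \<open>(c - 1) / d\<close>. For \<open>r <= s = N - q\<close>, reflection
  writes the loss at \<open>s\<close> as a sum of \<open>hc\<close> over the first \<open>q\<close>
  codes. The first \<open>r\<close> of these terms combine with \<open>A r\<close> to the
  antisymmetric sum of \<open>g\<close>, which has to pay for the other \<open>c - 1\<close>
  terms.\<close>

lemma colex_sum_two_initial_segments:
  assumes d: "d \<ge> 50" and c: "1 \<le> c" "c \<le> d"
    and r: "1 \<le> r" "1 \<le> s" "r + s + c = 2 ^ (d - 2) + 1"
  shows "(2 ^ d - real c) / real d
    \<le> colex_sum inv_Suc (2 ^ (d - 2)) + colex_sum (inv_Suc \<circ> Suc) r + colex_sum (inv_Suc \<circ> Suc) s"
proof -
  define k where "k = d - 2"
  define A where "A = colex_sum (inv_Suc \<circ> Suc)"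
  define g where "g i = inv_Suc (Suc i) - inv_Suc (Suc (k - i))" for i
  define hc where "hc i = inv_Suc (Suc (k - i))" for i
  have d_k: "d = Suc (Suc k)" using d by (simp add: k_def)
  have key: "A (2 ^ k) - (real c - 1) / real d \<le> A r + A s"
    if r: "1 \<le> r" "r \<le> s" "r + s + c = 2 ^ k + 1" for r s
  proof -
    define q where "q = r + c - 1"
    have s: "s = 2 ^ k - q" "q \<le> 2 ^ k" using r by (auto simp: q_def)
    have A_s: "A s = A (2 ^ k) - colex_sum hc q"
      using colex_sum_complement [OF s(2), of "inv_Suc \<circ> Suc"]
      by (simp add: A_def s(1) hc_def [abs_def] comp_def)
    have split: "colex_sum hc q = colex_sum hc r + (\<Sum>j=r..<q. hc (digit_sum j))"
      unfolding colex_sum_def using c by (simp add: q_def lessThan_atLeast0 sum.atLeastLessThan_concat)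
    have g: "colex_sum g r = A r - colex_sum hc r"
      by (simp add: colex_sum_def A_def g_def hc_def sum_subtractf)
    have card_q: "real (card {r..<q}) = real c - 1" using c by (simp add: q_def)
    \<comment> \<open>If \<open>q <= 2 ^ l\<close>, all digit sums involved are at most about a
      third of \<open>d\<close>, so that \<open>hc\<close> is close to \<open>1 / d\<close>;
      otherwise \<open>r\<close> is exponentially large.\<close>
    define l where "l = k div 3"
    have l: "16 \<le> l" "3 * l + 2 \<le> d" "d \<le> 3 * l + 4" using d by (auto simp: l_def d_k)
    have "(\<Sum>j=r..<q. hc (digit_sum j)) \<le> colex_sum g r + (real c - 1) / real d"
    proof (cases "q \<le> 2 ^ l")
      case True
      have "hc (digit_sum j) \<le> 1 / (real d - real l)" if "j \<in> {r..<q}" for j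
      proof -
        have "digit_sum j \<le> l" using that True by (intro digit_sum_le) auto
        then show ?thesis using l(2) unfolding hc_def
          by (intro divide_left_mono mult_pos_pos) (auto simp: d_k)
      qed
      then have "(\<Sum>j=r..<q. hc (digit_sum j)) \<le> (real c - 1) * (1 / (real d - real l))"
        unfolding card_q [symmetric] by (rule sum_bounded_above)
      moreover have "(real c - 1) * (1 / (real d - real l)) - (real c - 1) / real d \<le> 1 / 2 - 1 / real d"
      proof -
        have "(real c - 1) * (1 / (real d - real l)) - (real c - 1) / real d
            = (real c - 1) / real d * (real l / (real d - real l))"
          using l d by (simp add: field_simps)
        also have "\<dots> \<le> 1 * (real l / (real d - real l))"
          using c l d by (intro mult_right_mono) auto
        also have "\<dots> \<le> 1 / 2 - 1 / real d"
        proof -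
          have ld: "3 * real l + 2 \<le> real d" using l(2) by linarith
          have "real l * (real d * 2) \<le> (real d - 2) * (real d - real l)"
          proof -
            have "(3 * real l + 2) * real d \<le> real d * real d" using ld by (intro mult_right_mono) auto
            then show ?thesis using ld by (simp add: algebra_simps)
          qed
          then show ?thesis using ld d by (simp add: divide_simps)
        qed
        finally show ?thesis .
      qed
      moreover have "1 / 2 - 1 / real d \<le> colex_sum g r"
      proof -
        \<comment> \<open>Only the code 0 is kept; the other terms are nonnegative because their
          digit sums lie below the centre of antisymmetry.\<close>
        have "g (digit_sum 0) \<le> (\<Sum>j<r. g (digit_sum j))"
        proof (rule member_le_sum)
          fix j assume "j \<in> {..<r} - {0}"
          then have "digit_sum j \<le> l" using True r c by (intro digit_sum_le) (auto simp: q_def)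
          then have "inv_Suc (Suc (k - digit_sum j)) \<le> inv_Suc (Suc (digit_sum j))"
            using l by (intro antimonoD [OF antimono_inv_Suc]) (auto simp: d_k)
          then show "0 \<le> g (digit_sum j)" by (simp add: g_def)
        qed (use r in auto)
        moreover have "g (digit_sum 0) = 1 / 2 - 1 / real d" by (simp add: g_def d_k)
        ultimately show ?thesis by (simp add: colex_sum_def)
      qed
      ultimately show ?thesis by linarith
    next
      case False
      \<comment> \<open>Twice this value is the bound of \<open>inverse_products_lower_bound\<close>
        with \<open>p + q = d + 2\<close>. Since \<open>r\<close> is large, \<open>e * r\<close>
        outweighs \<open>c - 1\<close> terms of size at most \<open>1 / 2\<close>.\<close>
      define e where "e = 2 / (real d + 2)^2"
      have "e * real r \<le> colex_sum g r"
      proof (rule colex_sum_antisymmetric(2))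
        show "g (k - i) = - g i" if "i \<le> k" for i using that by (simp add: g_def)
        show "g (Suc i) + 2 * e \<le> g i" if "i < k" for i
        proof -
          define p q where "p = real i + 2" and "q = real d - real i"
          have q: "q > 1" "p \<ge> 1" using that by (auto simp: p_def q_def d_k)
          have "4 / (p + q)^2 \<le> 1 / p - 1 / (p + 1) + (1 / (q - 1) - 1 / q)"
            using q by (intro inverse_products_lower_bound)
          moreover have "p + q = real d + 2" by (simp add: p_def q_def)
          moreover have "real (k - i) = real k - real i" "real (k - Suc i) = real k - real i - 1"
            using that by auto
          then have "g i = 1 / p - 1 / q" "g (Suc i) = 1 / (p + 1) - 1 / (q - 1)"
            by (simp_all add: g_def p_def q_def d_k algebra_simps)
          ultimately show ?thesis by (simp add: e_def)
        qed
        show "r \<le> 2 ^ k" using r by linarith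
        show "2 * r \<le> 2 ^ k" using r c by linarith
        show "0 < k" using d by (simp add: d_k)
      qed (simp add: e_def)
      moreover have "(real c - 1) / 2 \<le> e * real r"
      proof -
        have "(3 * l + 6)^2 * (3 * l + 3) + 4 * (3 * l + 4) \<le> 4 * (2::nat) ^ l"
          using cube_le_power_two [OF l(1)] .
        moreover have "(d + 2)^2 * (d - 1) \<le> (3 * l + 6)^2 * (3 * l + 3)"
          using l by (intro mult_mono power_mono) auto
        moreover have "2 ^ l \<le> r + d" using False c by (auto simp: q_def)
        then have "4 * 2 ^ l \<le> 4 * (r + (3 * l + 4))"
          using l(3) by (intro mult_le_mono2) (meson add_left_mono le_trans)
        then have "4 * 2 ^ l \<le> 4 * r + 4 * (3 * l + 4)" by (simp only: distrib_left)
        ultimately have "(d + 2)^2 * (d - 1) + 4 * (3 * l + 4) \<le> 4 * r + 4 * (3 * l + 4)"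
          by (meson add_le_mono1 le_trans)
        then have "(d + 2)^2 * (d - 1) \<le> 4 * r" by (simp only: add_le_cancel_right)
        then have "real ((d + 2)^2 * (d - 1)) \<le> real (4 * r)" by (simp only: of_nat_le_iff)
        then have "(real d + 2)^2 * (real d - 1) \<le> 4 * real r"
          using d by (simp add: of_nat_diff add.commute)
        moreover have "(real d + 2)^2 * (real c - 1) \<le> (real d + 2)^2 * (real d - 1)"
          using c by (intro mult_left_mono) auto
        ultimately have "(real d + 2)^2 * (real c - 1) \<le> 4 * real r" by (rule order_trans [rotated])
        moreover have "(real d + 2)^2 > 0" by simp
        ultimately show ?thesis unfolding e_def by (simp add: field_simps)
      qed
      moreover have "(\<Sum>j=r..<q. hc (digit_sum j)) \<le> (real c - 1) * (1 / 2)"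
        unfolding card_q [symmetric] by (rule sum_bounded_above) (auto simp: hc_def)
      moreover have "0 \<le> (real c - 1) / real d" using c by simp
      ultimately show ?thesis by linarith
    qed
    then show ?thesis using A_s split g by linarith
  qed
  have "A (2 ^ k) - (real c - 1) / real d \<le> A r + A s"
    using key [of r s] key [of s r] r by (cases "r \<le> s") (auto simp: k_def algebra_simps)
  moreover have "colex_sum inv_Suc (2 ^ k) + A (2 ^ k) = (2 ^ d - 1) / real d"
    using colex_sum_inv_Suc_cube [of d] d by (simp add: k_def A_def)
  moreover have "(2 ^ d - 1) / real d - (real c - 1) / real d = (2 ^ d - real c) / real d"
    by (simp add: diff_divide_distrib)
  ultimately show ?thesis unfolding A_def k_def by linarith
qed

section \<open>Weights of hereditary families\<close>

definition link :: "'a set set \<Rightarrow> 'a \<Rightarrow> 'a set set" where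
  "link F x = {B. x \<notin> B \<and> insert x B \<in> F}"

lemma hereditary_subset: "hereditary F \<Longrightarrow> H \<in> F \<Longrightarrow> G \<subseteq> H \<Longrightarrow> G \<in> F"
  by (auto simp: hereditary_def)

lemma hereditary_link: "hereditary F \<Longrightarrow> hereditary (link F x)"
  unfolding hereditary_def link_def by (blast intro: insert_mono)

lemma link_subset: "hereditary F \<Longrightarrow> link F x \<subseteq> {B \<in> F. x \<notin> B}"
  unfolding hereditary_def link_def by blast

lemma insert_image_link: "insert x ` link F x = {A \<in> F. x \<in> A}"
proof -
  have "A \<in> insert x ` link F x" if "A \<in> F" "x \<in> A" for A
    using that by (intro image_eqI [of _ _ "A - {x}"]) (auto simp: link_def insert_absorb)
  then show ?thesis by (auto simp: link_def)
qed

lemma inj_on_insert_link: "inj_on (insert x) (link F x)"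
  by (rule inj_onI) (auto simp: link_def)

lemma finite_link: "finite F \<Longrightarrow> finite (link F x)"
  using finite_imageD [OF _ inj_on_insert_link] by (metis finite_Collect_conjI insert_image_link finite_subset Collect_mem_eq)

lemma sum_containing: "(\<Sum>A\<in>{A \<in> F. x \<in> A}. f A) = (\<Sum>B\<in>link F x. f (insert x B))"
  by (simp add: insert_image_link [symmetric] sum.reindex [OF inj_on_insert_link])

lemma card_link: "card (link F x) = deg F x"
  by (metis card_image deg_def inj_on_insert_link insert_image_link)

lemma hereditary_finite_member: "finite F \<Longrightarrow> hereditary F \<Longrightarrow> A \<in> F \<Longrightarrow> finite A"
  by (metis PowD finite_Pow_iff hereditary_subset rev_finite_subset subsetI)

lemma weight_eq_sum_link:
  assumes "finite F" "hereditary F"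
  shows "weight F x = (\<Sum>B\<in>link F x. inv_Suc (card B))"
  unfolding weight_def sum_containing
proof (rule sum.cong [OF refl])
  fix B assume B: "B \<in> link F x"
  then have "finite B"
    by (rule hereditary_finite_member [OF finite_link [OF assms(1)] hereditary_link [OF assms(2)]])
  with B show "1 / real (card (insert x B)) = inv_Suc (card B)" by (simp add: link_def)
qed

lemma sum_split_link:
  assumes "finite F"
  shows "(\<Sum>A\<in>F. f A) = (\<Sum>A\<in>{A \<in> F. x \<notin> A}. f A) + (\<Sum>B\<in>link F x. f (insert x B))"
proof -
  have "sum f F = sum f ({A \<in> F. x \<notin> A} \<union> {A \<in> F. x \<in> A})"
    by (rule arg_cong [where f = "sum f"]) blast
  also have "\<dots> = sum f {A \<in> F. x \<notin> A} + sum f {A \<in> F. x \<in> A}"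
    using assms by (intro sum.union_disjoint) auto
  finally show ?thesis by (simp only: sum_containing)
qed

lemma card_split_link:
  assumes "finite F"
  shows "card F = card {A \<in> F. x \<notin> A} + card (link F x)"
  using sum_split_link [OF assms, of "\<lambda>_. 1 :: nat" x] by simp

lemma hereditary_avoiding: "hereditary F \<Longrightarrow> hereditary {A \<in> F. x \<notin> A}"
  unfolding hereditary_def by blast

text \<open>Induction on the ground set: the members avoiding \<open>v\<close> are at least as many
  as the link of \<open>v\<close>, so \<open>colex_sum_split\<close> applies. The function
  \<open>h\<close> is generalised because the link is measured by
  \<open>h \<circ> Suc\<close>.\<close>

lemma hereditary_colex_bound:
  assumes "finite C" "hereditary C" "antimono h"
  shows "colex_sum h (card C) \<le> (\<Sum>B\<in>C. h (card B))"
proof -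
  have "colex_sum h (card C) \<le> (\<Sum>B\<in>C. h (card B))" if "finite V" "C \<subseteq> Pow V" for V
    using that assms
  proof (induction V arbitrary: C h rule: finite_induct)
    case empty
    then have "C = {} \<or> C = {{}}" by auto
    then show ?case by (auto simp: colex_sum_1)
  next
    case (insert v V)
    note C = insert.prems
    let ?C0 = "{A \<in> C. v \<notin> A}" and ?C1 = "link C v"
    have fin: "finite ?C1" "finite ?C0" using C(2) by (auto intro: finite_link)
    have "card ?C1 \<le> card ?C0" using fin link_subset [OF C(3)] by (intro card_mono)
    then have "colex_sum h (card C) \<le> colex_sum h (card ?C0) + colex_sum (h \<circ> Suc) (card ?C1)"
      unfolding card_split_link [OF C(2), of v] by (rule colex_sum_split [OF C(4)])
    also have "\<dots> \<le> (\<Sum>B\<in>?C0. h (card B)) + (\<Sum>B\<in>?C1. (h \<circ> Suc) (card B))"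
      using C fin
      by (intro add_mono insert.IH hereditary_avoiding hereditary_link antimono_comp_Suc)
        (auto simp: link_def)
    also have "(\<Sum>B\<in>?C1. (h \<circ> Suc) (card B)) = (\<Sum>B\<in>?C1. h (card (insert v B)))"
    proof (intro sum.cong refl)
      fix B assume B: "B \<in> ?C1"
      then have "finite B" using C insert.hyps(1) by (auto simp: link_def intro: finite_subset)
      with B show "(h \<circ> Suc) (card B) = h (card (insert v B))" by (simp add: link_def)
    qed
    also have "(\<Sum>B\<in>?C0. h (card B)) + (\<Sum>B\<in>?C1. h (card (insert v B))) = (\<Sum>B\<in>C. h (card B))"
      using sum_split_link [OF C(2), of "\<lambda>B. h (card B)" v] by simp
    finally show ?case .
  qed
  moreover have "finite (\<Union>C)" using assms by (auto intro: hereditary_finite_member)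
  ultimately show ?thesis by blast
qed

text \<open>The members that meet \<open>E\<close> need not form a hereditary family. They are
  peeled off point by point: those through \<open>z\<close> correspond to a link, which is measured
  by \<open>h \<circ> Suc\<close>, and subadditivity joins the pieces. The lemma serves to bound the
  weight of the sets that leave a block.\<close>

lemma hereditary_meeting_colex_bound:
  assumes "finite E" "finite C" "hereditary C" "antimono h"
  shows "colex_sum (h \<circ> Suc) (card {B \<in> C. B \<inter> E \<noteq> {}}) \<le> (\<Sum>B\<in>{B \<in> C. B \<inter> E \<noteq> {}}. h (card B))"
  using assms
proof (induction E arbitrary: C rule: finite_induct)
  case empty
  then show ?case by simp
next
  case (insert z E)
  note C = insert.prems
  let ?C0 = "{B \<in> C. z \<notin> B}" and ?M = "\<lambda>C. {B \<in> C. B \<inter> E \<noteq> {}}"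
  have split: "{B \<in> C. B \<inter> insert z E \<noteq> {}} = ?M ?C0 \<union> {B \<in> C. z \<in> B}"
    by auto
  have disj: "?M ?C0 \<inter> {B \<in> C. z \<in> B} = {}" by auto
  have card: "card {B \<in> C. B \<inter> insert z E \<noteq> {}} = card (?M ?C0) + card (link C z)"
    unfolding split using C(1) by (subst card_Un_disjoint [OF _ _ disj]) (auto simp: card_link deg_def)
  have "colex_sum (h \<circ> Suc) (card {B \<in> C. B \<inter> insert z E \<noteq> {}})
      \<le> colex_sum (h \<circ> Suc) (card (?M ?C0)) + colex_sum (h \<circ> Suc) (card (link C z))"
    unfolding card by (intro colex_sum_subadditive antimono_comp_Suc C(3))
  also have "\<dots> \<le> (\<Sum>B\<in>?M ?C0. h (card B)) + (\<Sum>B\<in>link C z. (h \<circ> Suc) (card B))"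
    using C by (intro add_mono insert.IH hereditary_colex_bound hereditary_avoiding hereditary_link
        antimono_comp_Suc finite_link) auto
  also have "(\<Sum>B\<in>link C z. (h \<circ> Suc) (card B)) = (\<Sum>B\<in>{B \<in> C. z \<in> B}. h (card B))"
    unfolding sum_containing
  proof (intro sum.cong refl)
    fix B assume B: "B \<in> link C z"
    then have "finite B"
      by (rule hereditary_finite_member [OF finite_link [OF C(1)] hereditary_link [OF C(2)]])
    with B show "(h \<circ> Suc) (card B) = h (card (insert z B))" by (simp add: link_def)
  qed
  also have "(\<Sum>B\<in>?M ?C0. h (card B)) + (\<Sum>B\<in>{B \<in> C. z \<in> B}. h (card B))
      = (\<Sum>B\<in>{B \<in> C. B \<inter> insert z E \<noteq> {}}. h (card B))"
    unfolding split using C(1) by (subst sum.union_disjoint [OF _ _ disj]) auto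
  finally show ?case .
qed

lemma hereditary_sum_card_bound:
  assumes "finite C" "hereditary C"
  shows "(\<Sum>B\<in>C. real (card B)) \<le> colex_sum real (card C)"
  using hereditary_colex_bound [OF assms, of "\<lambda>i. - real i"]
  by (simp add: antimono_def sum_negf colex_sum_def)

lemma sum_deg:
  assumes "finite F" "finite V" "F \<subseteq> Pow V"
  shows "(\<Sum>v\<in>V. deg F v) = (\<Sum>A\<in>F. card A)"
proof -
  have "(\<Sum>v\<in>V. deg F v) = (\<Sum>v\<in>V. \<Sum>A\<in>F. if v \<in> A then 1 else 0)"
    unfolding deg_def using assms(1) by (simp add: sum.If_cases Int_def)
  also have "\<dots> = (\<Sum>A\<in>F. \<Sum>v\<in>V. if v \<in> A then 1 else 0)" by (rule sum.swap)
  also have "\<dots> = (\<Sum>A\<in>F. card A)"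
  proof (rule sum.cong [OF refl])
    fix A assume "A \<in> F"
    then have "V \<inter> A = A" using assms(3) by auto
    then show "(\<Sum>v\<in>V. if v \<in> A then 1 else 0) = card A" using assms(2) by (simp add: sum.If_cases)
  qed
  finally show ?thesis .
qed

lemma colex_sum_real_power: "2 * colex_sum real (2 ^ k) = real k * 2 ^ k"
proof (induction k)
  case 0
  show ?case by (simp add: colex_sum_1)
next
  case (Suc k)
  then show ?case using colex_sum_double [of real "2 ^ k"]
    by (simp add: colex_sum_real_Suc_comp algebra_simps)
qed

lemma square_less_power_two:
  assumes "50 \<le> d"
  shows "d * d < (2::nat) ^ (d - 3)" "(2::nat) ^ (d - 2) = 2 * 2 ^ (d - 3)" "(2::nat) ^ (d - 1) = 4 * 2 ^ (d - 3)"
    "(2::nat) ^ d = 8 * 2 ^ (d - 3)"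
proof -
  have "0 < d * d" using assms by simp
  then show "d * d < (2::nat) ^ (d - 3)"
    using cubic_le_power_two [OF assms] unfolding power2_eq_square by linarith
  have "d = Suc (Suc (Suc (d - 3)))" using assms by linarith
  then obtain e where "d = Suc (Suc (Suc e))" by blast
  then show "(2::nat) ^ (d - 2) = 2 * 2 ^ (d - 3)" "(2::nat) ^ (d - 1) = 4 * 2 ^ (d - 3)"
    "(2::nat) ^ d = 8 * 2 ^ (d - 3)"
    by simp_all
qed

text \<open>If every vertex were missed by at most \<open>N\<close> members, then
  \<open>card L <= 2 * N\<close> and all degrees would be at least \<open>card L - N\<close>. With
  \<open>d\<close> or more vertices the degree sum would then exceed \<open>(d - 1) * N\<close>, the
  sum of the first \<open>2 * N\<close> digit sums. So some \<open>v\<close> is missed by more than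
  \<open>N\<close> members, and the link splits there.\<close>

lemma wide_link_weight:
  assumes d: "d \<ge> 50" and c: "1 \<le> c" "c \<le> d"
    and L: "finite L" "hereditary L" "2 ^ (d - 1) + 1 \<le> card L + c" "d \<le> card (\<Union>L)"
  shows "(2 ^ d - real c) / real d \<le> (\<Sum>B\<in>L. inv_Suc (card B))"
proof -
  define N :: nat where "N = 2 ^ (d - 2)"
  note pow = square_less_power_two [OF d]
  have dN: "d * d < N" "2 ^ (d - 1) = 2 * N" using pow by (simp_all add: N_def)
  have d_dd: "d \<le> d * d" using d by simp
  let ?L0 = "\<lambda>v. {B \<in> L. v \<notin> B}"
  have card_L: "card L = card (?L0 v) + deg L v" for v
    using card_split_link [OF L(1)] by (simp add: card_link)
  have finU: "finite (\<Union>L)" using L(1,2) by (auto intro: hereditary_finite_member)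
  have "\<exists>v\<in>\<Union>L. N < card (?L0 v)"
  proof (rule ccontr)
    assume "\<not> ?thesis"
    then have le: "card (?L0 v) \<le> N" if "v \<in> \<Union>L" for v using that by (meson linorder_not_le)
    have "\<Union>L \<noteq> {}" using L(4) d by (metis card.empty le_zero_eq not_numeral_le_zero)
    then obtain v where v: "v \<in> \<Union>L" by blast
    have "deg L v \<le> card (?L0 v)"
      unfolding card_link [symmetric] using L(1) link_subset [OF L(2)] by (intro card_mono) auto
    then have m: "card L \<le> 2 * N" using card_L [of v] le [OF v] by linarith
    have "real (card (\<Union>L)) * (real (card L) - real N) \<le> (\<Sum>v\<in>\<Union>L. real (deg L v))"
    proof (rule sum_bounded_below)
      fix v assume "v \<in> \<Union>L"
      then show "real (card L) - real N \<le> real (deg L v)" using card_L [of v] le [of v] by linarith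
    qed
    also have "\<dots> = (\<Sum>B\<in>L. real (card B))"
      using sum_deg [OF L(1) finU Union_upper [THEN PowI, THEN subsetI]] by (simp flip: of_nat_sum)
    also have "\<dots> \<le> colex_sum real (card L)" by (rule hereditary_sum_card_bound [OF L(1,2)])
    also have "\<dots> \<le> colex_sum real (2 ^ (d - 1))"
      using m by (intro colex_sum_mono) (simp_all only: dN(2) of_nat_0_le_iff)
    also have "\<dots> = (real d - 1) * real N"
    proof -
      have "(2::real) ^ (d - 1) = 2 * real N"
        using arg_cong [OF dN(2), of real] by simp
      moreover have "real (d - 1) = real d - 1" using d by (simp add: of_nat_diff)
      ultimately show ?thesis using colex_sum_real_power [of "d - 1"] by simp
    qed
    finally have "real (card (\<Union>L)) * (real (card L) - real N) \<le> (real d - 1) * real N" .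
    moreover have NL: "real N + 1 - real c \<le> real (card L) - real N" using L(3) dN(2) by linarith
    have "real d * (real N + 1 - real c) \<le> real (card (\<Union>L)) * (real (card L) - real N)"
    proof (rule mult_mono)
      have "c \<le> N" using c d_dd dN(1) by linarith
      then show "0 \<le> real N + 1 - real c" by linarith
    qed (use L(4) NL in simp_all)
    moreover have "real d * (real c - 1) \<le> real d * real d"
      using c by (intro mult_left_mono) auto
    moreover have "real d * real d < real N"
      using dN(1) unfolding of_nat_mult [symmetric] of_nat_less_iff .
    moreover have "real d * (real N + 1 - real c) = real d * real N - real d * (real c - 1)"
      "(real d - 1) * real N = real d * real N - real N" by (simp_all add: algebra_simps)
    ultimately show False by linarith
  qed
  then obtain v where v: "v \<in> \<Union>L" and big: "N < card (?L0 v)" by blast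
  have "{} \<in> link L v" using v L(2) by (auto simp: link_def intro: hereditary_subset)
  then have deg_pos: "1 \<le> deg L v"
    using finite_link [OF L(1), of v] by (metis One_nat_def Suc_leI card_gt_0_iff card_link empty_iff)
  have cN: "c < N" using dN(1) c d_dd by linarith
  \<comment> \<open>\<open>N + r\<close> members avoiding \<open>v\<close> and \<open>s\<close>
    members through \<open>v\<close> are counted, with \<open>r + s = N + 1 - c\<close>. Capping
    \<open>r\<close> at \<open>N - c\<close> keeps \<open>s\<close> positive.\<close>
  define r where "r = min (card (?L0 v) - N) (N - c)"
  define s where "s = N + 1 - c - r"
  have r: "1 \<le> r" "r \<le> N" "N + r \<le> card (?L0 v)" using big cN unfolding r_def by linarith+
  have s: "1 \<le> s" "r + s + c = N + 1" using cN unfolding r_def s_def by linarith+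
  have "s \<le> deg L v"
    using deg_pos card_L [of v] L(3) big cN unfolding dN(2) r_def s_def by linarith
  have "(2 ^ d - real c) / real d
      \<le> colex_sum inv_Suc N + colex_sum (inv_Suc \<circ> Suc) r + colex_sum (inv_Suc \<circ> Suc) s"
    unfolding N_def by (rule colex_sum_two_initial_segments) (use d c r s N_def in auto)
  also have "colex_sum inv_Suc N + colex_sum (inv_Suc \<circ> Suc) r = colex_sum inv_Suc (N + r)"
    using r unfolding N_def by (intro colex_sum_power_add [symmetric])
  finally have "(2 ^ d - real c) / real d \<le> colex_sum inv_Suc (N + r) + colex_sum (inv_Suc \<circ> Suc) s" .
  moreover have "colex_sum inv_Suc (N + r) \<le> colex_sum inv_Suc (card (?L0 v))"
    using r by (intro colex_sum_mono) auto
  moreover have "\<dots> \<le> (\<Sum>B\<in>?L0 v. inv_Suc (card B))"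
    using L by (intro hereditary_colex_bound hereditary_avoiding antimono_inv_Suc) auto
  moreover have "colex_sum (inv_Suc \<circ> Suc) s \<le> colex_sum (inv_Suc \<circ> Suc) (card (link L v))"
    using \<open>s \<le> deg L v\<close> by (intro colex_sum_mono) (auto simp: card_link)
  moreover have "\<dots> \<le> (\<Sum>B\<in>link L v. (inv_Suc \<circ> Suc) (card B))"
    using L by (intro hereditary_colex_bound hereditary_link antimono_comp_Suc antimono_inv_Suc finite_link) auto
  moreover have "\<dots> = (\<Sum>B\<in>link L v. inv_Suc (card (insert v B)))"
  proof (intro sum.cong refl)
    fix B assume B: "B \<in> link L v"
    then have "finite B"
      by (rule hereditary_finite_member [OF finite_link [OF L(1)] hereditary_link [OF L(2)]])
    with B show "(inv_Suc \<circ> Suc) (card B) = inv_Suc (card (insert v B))" by (simp add: link_def)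
  qed
  moreover have "(\<Sum>B\<in>L. inv_Suc (card B))
      = (\<Sum>B\<in>?L0 v. inv_Suc (card B)) + (\<Sum>B\<in>link L v. inv_Suc (card (insert v B)))"
    by (rule sum_split_link [OF L(1)])
  ultimately show ?thesis by linarith
qed

section \<open>Compensation inside a block\<close>

text \<open>In the application \<open>K\<close> counts the points of degree at least
  \<open>s - 2\<close> in a family of \<open>m\<close> sets. The required inequality is concave and
  quadratic in \<open>s\<close>, so it is enough to check both ends of the range of
  \<open>s\<close>.\<close>

lemma block_numeric:
  fixes d s m K :: real
  assumes d: "50 \<le> d" and s: "d + 5 \<le> 8 * s" "s \<le> d - 1" and m: "0 \<le> m" "m \<le> d - 1 + s"
    and K: "256 * (K * (s - 2)) \<le> m * (576 + 3 * m)"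
  shows "6 * s \<le> 7 * (d - K)"
proof (rule ccontr)
  assume "\<not> ?thesis"
  then have "7 * d - 6 * s < 7 * K" by simp
  moreover have s2: "0 < s - 2" using d s by linarith
  ultimately have "(7 * d - 6 * s) * (s - 2) < 7 * K * (s - 2)" by (intro mult_strict_right_mono)
  then have "256 * ((7 * d - 6 * s) * (s - 2)) < 7 * (256 * (K * (s - 2)))"
    unfolding mult.assoc by linarith
  also have "\<dots> \<le> 7 * (m * (576 + 3 * m))" using K by simp
  also have "\<dots> \<le> 7 * ((d - 1 + s) * (576 + 3 * (d - 1 + s)))"
    using m by (intro mult_left_mono mult_mono) auto
  finally have neg: "256 * ((7 * d - 6 * s) * (s - 2)) < 7 * ((d - 1 + s) * (576 + 3 * (d - 1 + s)))" .
  define f where "f s = 256 * ((7 * d - 6 * s) * (s - 2)) - 7 * ((d - 1 + s) * (576 + 3 * (d - 1 + s)))" for s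
  define u w where "u = s - (d + 5) / 8" and "w = d - 1 - s"
  have uw: "0 \<le> u" "0 \<le> w" "0 < u + w" using s d by (auto simp: u_def w_def)
  have dd: "50 * d \<le> d * d" using d by (intro mult_right_mono) auto
  have f0: "0 \<le> f ((d + 5) / 8)"
  proof -
    have "64 * f ((d + 5) / 8) = 11099 * (d * d) - 437650 * d + 181059"
      by (simp add: f_def field_simps)
    then show ?thesis using dd d by linarith
  qed
  have f1: "0 \<le> f (d - 1)"
  proof -
    have "f (d - 1) = 172 * (d * d) - 7128 * d + 3372"
      by (simp add: f_def algebra_simps)
    then show ?thesis using dd d by linarith
  qed
  \<comment> \<open>\<open>f\<close> has leading coefficient \<open>-1557\<close>, so it equals its
    chord between the two endpoints plus \<open>1557 * u * w\<close>.\<close>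
  have "(u + w) * f s = 1557 * (u * w) * (u + w) + f ((d + 5) / 8) * w + f (d - 1) * u"
    by (simp add: f_def u_def w_def field_simps)
  moreover have "0 \<le> 1557 * (u * w) * (u + w)" "0 \<le> f ((d + 5) / 8) * w" "0 \<le> f (d - 1) * u"
    using uw f0 f1 by simp_all
  ultimately have "0 \<le> (u + w) * f s" by linarith
  then have "0 \<le> f s" using uw by (simp add: zero_le_mult_iff)
  then show False using neg by (simp add: f_def)
qed

lemma sum_ge_card_mult:
  fixes f :: "'a \<Rightarrow> real"
  assumes "finite D" "Y \<subseteq> D" "\<And>v. v \<in> D \<Longrightarrow> 0 \<le> f v" "\<And>v. v \<in> Y \<Longrightarrow> e \<le> f v"
  shows "real (card Y) * e \<le> sum f D"
proof -
  have "real (card Y) * e \<le> sum f Y" using assms(4) by (rule sum_bounded_below)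
  also have "\<dots> \<le> sum f D" using assms by (intro sum_mono2) auto
  finally show ?thesis .
qed

text \<open>\<open>C\<close> stands for the complements of the missing subsets of the block, and
  \<open>t v\<close> for the number of sets through \<open>v\<close> that leave it. For
  \<open>card C >= c\<close> the left side is \<open>s = card C + 1 - c\<close>, lowered by
  \<open>1 / 2\<close> if \<open>c = d\<close>. A point with \<open>t v >= 1\<close> contributes at
  least \<open>1 / 2\<close>, and one with \<open>t v >= 3\<close> at least \<open>7 / 6\<close>.
  Points with small \<open>t v\<close> have large degree in \<open>C\<close>, and \<open>C\<close>
  has room for few of them.\<close>

lemma block_excess:
  assumes d: "d \<ge> 50" and c: "1 \<le> c" "c \<le> d"
    and D: "finite D" "card D = d" and C: "C \<subseteq> Pow D" "hereditary C"
    and t: "\<And>v. v \<in> D \<Longrightarrow> card C + 1 \<le> deg C v + t v + c" and x: "x \<in> D" "t x = 0"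
  shows "real (card C) + (if c = d then 1 / 2 else 1) - real c
    \<le> (\<Sum>v\<in>D. colex_sum (inv_Suc \<circ> Suc) (t v))" (is "?lhs \<le> (\<Sum>v\<in>D. ?w v)")
proof -
  have w_nonneg: "0 \<le> ?w v" for v using colex_sum_mono [of "inv_Suc \<circ> Suc" 0 "t v"] by simp
  show ?thesis
  proof (cases "card C < c")
    case True
    then have "?lhs \<le> 0" by simp
    also have "0 \<le> (\<Sum>v\<in>D. ?w v)" by (intro sum_nonneg w_nonneg)
    finally show ?thesis .
  next
    case False
    define s where "s = card C + 1 - c"
    have s: "1 \<le> s" "card C + 1 = c + s" using False by (auto simp: s_def)
    have finC: "finite C" using C(1) D(1) by (auto intro: finite_subset)
    define X where "X = {v \<in> D. t v = 0}"
    have X: "X \<subseteq> D" "finite X" "x \<in> X" using D x by (auto simp: X_def)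
    have degX: "s \<le> deg C v" if "v \<in> X" for v using t [of v] that s by (auto simp: X_def)
    have card_C: "card C = card {S \<in> C. v \<notin> S} + deg C v" for v
      using card_split_link [OF finC] by (simp add: card_link)
    \<comment> \<open>Members of \<open>C\<close> through \<open>x\<close> inject into those
      avoiding \<open>x\<close>, so \<open>2 * s <= card C = c + s - 1\<close>.\<close>
    have s_c: "s + 1 \<le> c"
    proof -
      have "deg C x \<le> card {S \<in> C. x \<notin> S}"
        unfolding card_link [symmetric] using finC link_subset [OF C(2)] by (intro card_mono) auto
      then show ?thesis using card_C [of x] degX [OF X(3)] s by linarith
    qed
    have single: "{v} \<in> C" if "v \<in> X" for v
    proof -
      have "deg C v \<noteq> 0" using degX [OF that] s by linarith
      then obtain S where "S \<in> C" "v \<in> S" unfolding deg_def by (metis (mono_tags, lifting) card.empty empty_Collect_eq)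
      then show ?thesis using C(2) by (auto intro: hereditary_subset)
    qed
    have empty: "{} \<in> C" using single [OF X(3)] C(2) by (auto intro: hereditary_subset)
    \<comment> \<open>The empty set and the singletons of the other points of \<open>X\<close> avoid
      \<open>x\<close>, while at least \<open>s\<close> members of \<open>C\<close> contain
      it.\<close>
    have a_c: "card X + 1 \<le> c"
    proof -
      have "insert {} ((\<lambda>v. {v}) ` (X - {x})) \<subseteq> {S \<in> C. x \<notin> S}" using empty single by auto
      then have "card (insert {} ((\<lambda>v. {v}) ` (X - {x}))) \<le> card {S \<in> C. x \<notin> S}"
        using finC by (intro card_mono) auto
      moreover have "card (insert {} ((\<lambda>v. {v}) ` (X - {x}))) = Suc (card (X - {x}))"
        using X(2) by (subst card_insert_disjoint) (auto simp: card_image)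
      moreover have "Suc (card (X - {x})) = card X" using X by (intro card_Suc_Diff1)
      ultimately show ?thesis using card_C [of x] degX [OF X(3)] s by linarith
    qed
    have b: "card (D - X) + card X = d"
      using card_Diff_subset [OF X(2,1)] card_mono [OF D(1) X(1)] D(2) by simp
    have half: "real (card (D - X)) * (1 / 2) \<le> (\<Sum>v\<in>D. ?w v)"
    proof (rule sum_ge_card_mult [OF D(1)])
      fix v assume "v \<in> D - X"
      then have "1 \<le> t v" by (auto simp: X_def)
      then have "colex_sum (inv_Suc \<circ> Suc) 1 \<le> ?w v" by (intro colex_sum_mono) auto
      then show "1 / 2 \<le> ?w v" by (simp add: colex_sum_1)
    qed (use w_nonneg in auto)
    have lhs: "?lhs = real s - (if c = d then 1 / 2 else 0)" 
    proof -
      have "real (card C) + 1 = real c + real s" using s(2) by linarith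
      then show ?thesis by simp
    qed
    consider "s = 1" | "2 \<le> s" "8 * s \<le> d + 4" | "2 \<le> s" "d + 5 \<le> 8 * s" using s(1) by linarith
    then show ?thesis
    proof cases
      case 1
      show ?thesis
      proof (cases "2 \<le> card (D - X)")
        case True
        then show ?thesis using half lhs 1 by (simp split: if_splits)
      next
        case False
        \<comment> \<open>A single point outside \<open>X\<close> contributes only
          \<open>1 / 2\<close>; this is where the extra \<open>1 / 2\<close> in
          \<open>frakB d d\<close> is used.\<close>
        then have "c = d" "card (D - X) = 1" using b a_c c by linarith+
        then show ?thesis using half lhs 1 by simp
      qed
    next
      case 2
      \<comment> \<open>Since \<open>s >= 2\<close>, every point of \<open>X\<close> lies in a pair
        belonging to \<open>C\<close>. So \<open>C\<close> has at least
        \<open>1 + card X + card X / 2\<close> members, which leaves \<open>2 * s\<close> or more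
        points outside \<open>X\<close>.\<close>
      define P where "P = {S \<in> C. card S = 2}"
      have "X \<subseteq> \<Union>P"
      proof
        fix v assume v: "v \<in> X"
        have "\<not> {S \<in> C. v \<in> S} \<subseteq> {{v}}"
        proof
          assume "{S \<in> C. v \<in> S} \<subseteq> {{v}}"
          then have "deg C v \<le> card {{v}}" unfolding deg_def by (intro card_mono) auto
          then show False using degX [OF v] 2(1) by simp
        qed
        then obtain S where S: "S \<in> C" "v \<in> S" "S \<noteq> {v}" by auto
        then obtain z where "z \<in> S" "z \<noteq> v" by blast
        then have "{v, z} \<in> P" using S C(2) by (auto simp: P_def intro: hereditary_subset)
        then show "v \<in> \<Union>P" by blast
      qed
      have finP: "finite P" using finC by (simp add: P_def)
      have "\<Union>P \<subseteq> D" using C(1) by (auto simp: P_def)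
      then have "card X \<le> card (\<Union>P)"
        using \<open>X \<subseteq> \<Union>P\<close> finite_subset [OF _ D(1)] by (intro card_mono)
      also have "\<dots> \<le> (\<Sum>S\<in>P. card S)" by (rule card_Union_le_sum_card)
      also have "\<dots> = 2 * card P" by (simp add: P_def)
      finally have XP: "card X \<le> 2 * card P" .
      have "card (insert {} ((\<lambda>v. {v}) ` X) \<union> P) \<le> card C"
        using finC empty single by (intro card_mono) (auto simp: P_def)
      moreover have "card (insert {} ((\<lambda>v. {v}) ` X) \<union> P) = Suc (card X) + card P"
        using X(2) finP by (subst card_Un_disjoint) (auto simp: P_def card_image card_insert_if)
      ultimately have "2 * s \<le> card (D - X)" using XP s 2 b c(2) by linarith
      then have "real s \<le> real (card (D - X)) * (1 / 2)" by linarith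
      then show ?thesis using half lhs by (simp split: if_splits)
    next
      case 3
      \<comment> \<open>Outside \<open>Z\<close> one has \<open>t v >= 3\<close>, worth
        \<open>1/2 + 1/3 + 1/3 = 7/6\<close>. The bound on digit sums limits the degree sum of
        \<open>C\<close> and hence \<open>card Z\<close>.\<close>
      define Z where "Z = {v \<in> D. s \<le> deg C v + 2}"
      have Z: "Z \<subseteq> D" "finite Z" using D by (auto simp: Z_def)
      have bound: "7 / 6 \<le> ?w v" if "v \<in> D - Z" for v
      proof -
        have "3 \<le> t v" using that t [of v] s by (auto simp: Z_def)
        then have "colex_sum (inv_Suc \<circ> Suc) 3 \<le> ?w v" by (intro colex_sum_mono) auto
        moreover have "colex_sum (inv_Suc \<circ> Suc) 3 = 7 / 6"
          using digit_sum_Suc_double [of 0] digit_sum_double [of 1]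
          by (simp add: colex_sum_def eval_nat_numeral)
        ultimately show ?thesis by simp
      qed
      have "real (card Z) * (real s - 2) \<le> (\<Sum>v\<in>D. real (deg C v))"
        by (rule sum_ge_card_mult [OF D(1) Z(1)]) (auto simp: Z_def)
      also have "\<dots> = (\<Sum>S\<in>C. real (card S))"
        using sum_deg [OF finC D(1) C(1)] by (simp flip: of_nat_sum)
      also have "\<dots> \<le> colex_sum real (card C)" by (rule hereditary_sum_card_bound [OF finC C(2)])
      finally have "256 * (real (card Z) * (real s - 2)) \<le> real (card C) * (576 + 3 * real (card C))"
        using sum_digit_sum_bound [of "card C"] by linarith
      moreover have "real d + 5 \<le> 8 * real s" "real s \<le> real d - 1" "real (card C) \<le> real d - 1 + real s"
        using 3(2) s_c c(2) s(2) by linarith+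
      ultimately have "6 * real s \<le> 7 * (real d - real (card Z))"
        using d by (intro block_numeric [of _ _ "real (card C)"]) auto
      then have "6 * real s \<le> 7 * real (card (D - Z))"
        using card_Diff_subset [OF Z(2,1)] card_mono [OF D(1) Z(1)] D(2) by (simp add: of_nat_diff)
      then have "real s \<le> real (card (D - Z)) * (7 / 6)" by linarith
      also have "\<dots> \<le> (\<Sum>v\<in>D. ?w v)"
        by (rule sum_ge_card_mult [OF D(1)]) (use w_nonneg bound in auto)
      finally have "real s \<le> (\<Sum>v\<in>D. ?w v)" .
      then show ?thesis using lhs by (simp split: if_splits)
    qed
  qed
qed

section \<open>Blocks of a family of large minimum degree\<close>

lemma card_Pow_containing:
  assumes "finite D" "R \<subseteq> D"
  shows "card {A \<in> Pow D. R \<subseteq> A} = 2 ^ (card D - card R)"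
proof -
  have "{A \<in> Pow D. R \<subseteq> A} = (\<union>) R ` Pow (D - R)"
  proof
    show "{A \<in> Pow D. R \<subseteq> A} \<subseteq> (\<union>) R ` Pow (D - R)"
    proof
      fix A assume "A \<in> {A \<in> Pow D. R \<subseteq> A}"
      then show "A \<in> (\<union>) R ` Pow (D - R)" by (intro image_eqI [of _ _ "A - R"]) auto
    qed
  qed (use assms in auto)
  moreover have "inj_on ((\<union>) R) (Pow (D - R))" by (rule inj_onI) blast
  ultimately show ?thesis
    using assms by (simp add: card_image card_Pow card_Diff_subset finite_subset)
qed

text \<open>Each nonempty set spreads a total of 1 evenly over its points.\<close>

lemma sum_reciprocal_card:
  assumes "finite D" "finite G" "G \<subseteq> Pow D"
  shows "(\<Sum>v\<in>D. \<Sum>A\<in>{A \<in> G. v \<in> A}. 1 / real (card A)) = real (card (G - {{}}))"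
proof -
  have "(\<Sum>v\<in>D. \<Sum>A\<in>{A \<in> G. v \<in> A}. 1 / real (card A))
      = (\<Sum>v\<in>D. \<Sum>A\<in>G. if v \<in> A then 1 / real (card A) else 0)"
    using assms(2) by (simp add: sum.If_cases Int_def)
  also have "\<dots> = (\<Sum>A\<in>G. \<Sum>v\<in>D. if v \<in> A then 1 / real (card A) else 0)" by (rule sum.swap)
  also have "\<dots> = (\<Sum>A\<in>G. if A = {} then 0 else 1)"
  proof (rule sum.cong [OF refl])
    fix A assume "A \<in> G"
    then have "D \<inter> A = A" "finite A" using assms by (auto intro: finite_subset)
    then show "(\<Sum>v\<in>D. if v \<in> A then 1 / real (card A) else 0) = (if A = {} then 0 else 1)"
      using assms(1) by (simp add: sum.If_cases)
  qed
  also have "\<dots> = real (card (G - {{}}))"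
  proof -
    have "G \<inter> - {A. A = {}} = G - {{}}" by blast
    then show ?thesis using assms(2) by (simp add: sum.If_cases)
  qed
  finally show ?thesis .
qed

text \<open>The degree condition is written additively to stay clear of truncated subtraction on
  \<open>nat\<close>.\<close>

locale dense_hereditary =
  fixes F :: "'a set set" and V :: "'a set" and d c :: nat
  assumes d50: "d \<ge> 50" and c: "1 \<le> c" "c \<le> d"
    and finV: "finite V" and FV: "F \<subseteq> Pow V" and her: "hereditary F"
    and deg_ge: "\<And>x. x \<in> V \<Longrightarrow> 2 ^ (d - 1) + 1 \<le> deg F x + c"
begin

definition nbhd :: "'a \<Rightarrow> 'a set" where
  "nbhd x = \<Union>{A \<in> F. x \<in> A}"

text \<open>\<open>nbhd x\<close> contains \<open>x\<close> itself, so these are the vertices with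
  exactly \<open>d - 1\<close> neighbours, the minimum possible by
  \<open>card_nbhd_ge\<close>.\<close>

definition closed :: "'a \<Rightarrow> bool" where
  "closed x \<longleftrightarrow> x \<in> V \<and> card (nbhd x) = d"

definition blocks :: "'a set set" where
  "blocks = nbhd ` {x. closed x}"

lemma finF: "finite F"
  using FV finV by (auto intro: finite_subset)

lemma pow: "2 ^ (d - 2) = 2 * (2::nat) ^ (d - 3)" "2 ^ (d - 1) = 4 * (2::nat) ^ (d - 3)"
    "2 ^ d = 8 * (2::nat) ^ (d - 3)" and c_lt: "c < 2 ^ (d - 3)"
proof -
  note p = square_less_power_two [OF d50]
  show "2 ^ (d - 2) = 2 * (2::nat) ^ (d - 3)" "2 ^ (d - 1) = 4 * (2::nat) ^ (d - 3)"
    "2 ^ d = 8 * (2::nat) ^ (d - 3)" by (fact p)+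
  have "d \<le> d * d" using d50 by simp
  then show "c < 2 ^ (d - 3)" using p(1) c by linarith
qed

lemma frakB_le: "frakB d c \<le> (2 ^ d - real c) / real d"
  using d50 by (simp add: frakB_def divide_right_mono)

lemma frakB_times: "real d * frakB d c = 2 ^ d - real c - (if c = d then 1 / 2 else 0)"
  using d50 by (simp add: frakB_def)

lemma frakB_le_cube: "frakB d c \<le> colex_sum inv_Suc (2 ^ (d - 1))"
proof -
  have "frakB d c \<le> (2 ^ d - real c) / real d" by (rule frakB_le)
  also have "\<dots> \<le> (2 ^ d - 1) / real d" using c by (intro divide_right_mono) auto
  also have "\<dots> = colex_sum inv_Suc (2 ^ (d - 1))"
    using colex_sum_inverse_power [of "d - 1"] d50 by simp
  finally show ?thesis .
qed

lemma nbhd_subset: "nbhd x \<subseteq> V"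
  using FV by (auto simp: nbhd_def)

lemma finite_nbhd: "finite (nbhd x)"
  using nbhd_subset finV by (rule finite_subset)

lemma subset_nbhd: "A \<in> F \<Longrightarrow> x \<in> A \<Longrightarrow> A \<subseteq> nbhd x"
  by (auto simp: nbhd_def)

lemma self_in_nbhd:
  assumes "x \<in> V"
  shows "x \<in> nbhd x"
proof -
  have "deg F x \<noteq> 0" using deg_ge [OF assms] c_lt pow(2) by linarith
  then obtain A where "A \<in> F" "x \<in> A"
    unfolding deg_def by (metis (mono_tags, lifting) card.empty empty_Collect_eq)
  then show ?thesis by (auto simp: nbhd_def)
qed

lemma card_Pow_containing_point:
  assumes "x \<in> D" "finite D"
  shows "card {A \<in> Pow D. x \<in> A} = 2 ^ (card D - 1)"
  using card_Pow_containing [of D "{x}"] assms by simp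

lemma card_nbhd_ge:
  assumes "x \<in> V"
  shows "d \<le> card (nbhd x)"
proof (rule ccontr)
  assume "\<not> ?thesis"
  have "deg F x \<le> card {A \<in> Pow (nbhd x). x \<in> A}"
    unfolding deg_def using finite_nbhd subset_nbhd [of _ x] by (intro card_mono) auto
  also have "\<dots> = 2 ^ (card (nbhd x) - 1)"
    using assms by (intro card_Pow_containing_point self_in_nbhd finite_nbhd)
  also have "\<dots> \<le> 2 ^ (d - 2)"
    using \<open>\<not> d \<le> card (nbhd x)\<close> by (intro power_increasing) auto
  finally show False using deg_ge [OF assms] c_lt pow by linarith
qed

lemma weight_not_closed:
  assumes x: "x \<in> V" "\<not> closed x"
  shows "frakB d c \<le> weight F x"
proof -
  have "d < card (nbhd x)" using card_nbhd_ge [OF x(1)] x by (auto simp: closed_def)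
  moreover have "nbhd x = insert x (\<Union>(link F x))"
  proof -
    have "nbhd x = \<Union>(insert x ` link F x)" by (simp add: nbhd_def insert_image_link)
    moreover have "link F x \<noteq> {}" using deg_ge [OF x(1)] c_lt pow(2) card_link [of F x] by auto
    ultimately show ?thesis by auto
  qed
  then have "card (nbhd x) \<le> Suc (card (\<Union>(link F x)))" by (simp add: card_insert_le_m1 card_insert_if)
  ultimately have "d \<le> card (\<Union>(link F x))" by linarith
  then have "(2 ^ d - real c) / real d \<le> (\<Sum>B\<in>link F x. inv_Suc (card B))"
    using d50 c deg_ge [OF x(1)]
    by (intro wide_link_weight finite_link [OF finF] hereditary_link [OF her]) (auto simp: card_link)
  then show ?thesis using frakB_le weight_eq_sum_link [OF finF her] by simp
qed

lemma weight_ge_colex: "colex_sum inv_Suc (deg F x) \<le> weight F x"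
  unfolding weight_eq_sum_link [OF finF her] card_link [symmetric]
  by (intro hereditary_colex_bound finite_link [OF finF] hereditary_link [OF her] antimono_inv_Suc)

lemma colex_sum_truncate:
  assumes "\<And>i. h i \<le> 1"
  shows "colex_sum h (m + j) \<le> colex_sum h m + real j"
  by (induction j) (use assms in \<open>auto simp: colex_sum_Suc intro: order_trans add_mono\<close>)

text \<open>A crude bound: each of at most \<open>c\<close> lost sets costs at most 1. It is applied
  to blocks in which a shared vertex has an excess of larger order.\<close>

lemma weight_ge:
  assumes "x \<in> V"
  shows "frakB d c - real d \<le> weight F x"
proof -
  have "colex_sum inv_Suc (2 ^ (d - 1)) \<le> colex_sum inv_Suc (deg F x + c)"
    using deg_ge [OF assms] by (intro colex_sum_mono) auto
  also have "\<dots> \<le> colex_sum inv_Suc (deg F x) + real c" by (rule colex_sum_truncate) simp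
  finally show ?thesis using frakB_le_cube weight_ge_colex [of x] c by linarith
qed

text \<open>By \<open>deg_ge\<close>, fewer than \<open>c\<close> of the \<open>2 ^ (d - 1)\<close>
  subsets of \<open>nbhd x\<close> through \<open>x\<close> are missing from \<open>F\<close>, so
  fewer than \<open>c\<close> supersets of \<open>R\<close> are lost.\<close>

lemma closed_card_containing:
  assumes x: "closed x" and R: "x \<in> R" "R \<subseteq> nbhd x"
  shows "2 ^ (d - card R) < card {A \<in> F. R \<subseteq> A} + c"
proof -
  let ?D = "nbhd x"
  have x': "x \<in> V" "card ?D = d" using x by (auto simp: closed_def)
  have fin: "finite {A \<in> Pow ?D. x \<in> A}" "finite F" using finite_nbhd finF by auto
  have "card ({A \<in> Pow ?D. x \<in> A} - F) < c"
  proof -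
    have "{A \<in> Pow ?D. x \<in> A} - F = {A \<in> Pow ?D. x \<in> A} - {A \<in> F. x \<in> A}" by blast
    moreover have "card ({A \<in> Pow ?D. x \<in> A} - {A \<in> F. x \<in> A})
        = card {A \<in> Pow ?D. x \<in> A} - card {A \<in> F. x \<in> A}"
      using fin subset_nbhd [of _ x] by (intro card_Diff_subset) auto
    moreover have "card {A \<in> Pow ?D. x \<in> A} = 2 ^ (d - 1)"
      using card_Pow_containing_point [OF self_in_nbhd [OF x'(1)] finite_nbhd] x'(2) by simp
    ultimately have "card ({A \<in> Pow ?D. x \<in> A} - F) = 2 ^ (d - 1) - deg F x" by (simp add: deg_def)
    then show ?thesis using deg_ge [OF x'(1)] c by linarith
  qed
  moreover have "card {A \<in> Pow ?D. R \<subseteq> A} \<le> card ({A \<in> F. R \<subseteq> A} \<union> ({A \<in> Pow ?D. x \<in> A} - F))"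
    using fin R by (intro card_mono) auto
  moreover have "\<dots> \<le> card {A \<in> F. R \<subseteq> A} + card ({A \<in> Pow ?D. x \<in> A} - F)"
    by (rule card_Un_le)
  moreover have "card {A \<in> Pow ?D. R \<subseteq> A} = 2 ^ (d - card R)"
    using card_Pow_containing [OF finite_nbhd R(2)] x'(2) by simp
  ultimately show ?thesis by linarith
qed

text \<open>As \<open>2 ^ (d - 3)\<close> exceeds \<open>c\<close>, the points \<open>x\<close>,
  \<open>v\<close> and \<open>z\<close> lie in a common member of \<open>F\<close>.\<close>

lemma closed_nbhd_subset:
  assumes x: "closed x" and v: "v \<in> nbhd x"
  shows "nbhd x \<subseteq> nbhd v"
proof
  fix z assume z: "z \<in> nbhd x"
  let ?R = "{x, v, z}"
  have "?R \<subseteq> nbhd x" using v z self_in_nbhd [of x] x by (auto simp: closed_def)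
  then have "2 ^ (d - card ?R) < card {A \<in> F. ?R \<subseteq> A} + c"
    by (intro closed_card_containing [OF x]) auto
  moreover have "card ?R \<le> 3" by (simp add: card_insert_if)
  then have "(2::nat) ^ (d - 3) \<le> 2 ^ (d - card ?R)" by (intro power_increasing) auto
  ultimately have "card {A \<in> F. ?R \<subseteq> A} \<noteq> 0" using c_lt by linarith
  then obtain A where "A \<in> F" "?R \<subseteq> A" by (metis (mono_tags, lifting) card.empty empty_Collect_eq)
  then show "z \<in> nbhd v" using subset_nbhd [of A v] by auto
qed

lemma closed_nbhd_eq:
  assumes "closed x" "closed v" "v \<in> nbhd x"
  shows "nbhd v = nbhd x"
  using card_subset_eq [OF finite_nbhd closed_nbhd_subset [OF assms(1,3)]] assms
  by (simp add: closed_def)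

lemma finite_blocks: "finite blocks"
  using finV by (auto simp: blocks_def closed_def intro: finite_subset [of _ V])

lemma block_closed:
  assumes "D \<in> blocks"
  obtains x where "closed x" "D = nbhd x" "x \<in> D" "card D = d" "D \<subseteq> V" "finite D"
  using assms self_in_nbhd nbhd_subset finite_nbhd by (auto simp: blocks_def closed_def)

text \<open>The sets through \<open>v\<close> that leave \<open>D\<close> correspond to the members
  of the link meeting \<open>V - D\<close>.\<close>

lemma weight_split:
  assumes "v \<in> D"
  shows "(\<Sum>A\<in>{A \<in> {A \<in> F. A \<subseteq> D}. v \<in> A}. 1 / real (card A))
      + colex_sum (inv_Suc \<circ> Suc) (card {A \<in> F. v \<in> A \<and> \<not> A \<subseteq> D}) \<le> weight F v"
proof -
  let ?O = "{B \<in> link F v. B \<inter> (V - D) \<noteq> {}}"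
  have O: "insert v ` ?O = {A \<in> F. v \<in> A \<and> \<not> A \<subseteq> D}"
  proof -
    have "insert v ` ?O = {A \<in> insert v ` link F v. \<not> A \<subseteq> D}"
      using assms FV by (auto simp: link_def)
    then show ?thesis unfolding insert_image_link by auto
  qed
  have inj: "inj_on (insert v) ?O" using inj_on_insert_link by (rule inj_on_subset) auto
  have "weight F v = (\<Sum>A\<in>{A \<in> {A \<in> F. A \<subseteq> D}. v \<in> A} \<union> {A \<in> F. v \<in> A \<and> \<not> A \<subseteq> D}. 1 / real (card A))"
    unfolding weight_def by (rule sum.cong) auto
  also have "\<dots> = (\<Sum>A\<in>{A \<in> {A \<in> F. A \<subseteq> D}. v \<in> A}. 1 / real (card A))
      + (\<Sum>A\<in>{A \<in> F. v \<in> A \<and> \<not> A \<subseteq> D}. 1 / real (card A))"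
    using finF by (intro sum.union_disjoint) auto
  also have "(\<Sum>A\<in>{A \<in> F. v \<in> A \<and> \<not> A \<subseteq> D}. 1 / real (card A)) = (\<Sum>B\<in>?O. inv_Suc (card B))"
    unfolding O [symmetric] sum.reindex [OF inj]
  proof (rule sum.cong [OF refl])
    fix B assume B: "B \<in> ?O"
    then have "finite B"
      using hereditary_finite_member [OF finite_link [OF finF] hereditary_link [OF her]] by blast
    with B show "((\<lambda>A. 1 / real (card A)) \<circ> insert v) B = inv_Suc (card B)" by (simp add: link_def)
  qed
  finally show ?thesis
    using hereditary_meeting_colex_bound [of "V - D" "link F v" inv_Suc] finV finite_link [OF finF]
      hereditary_link [OF her] antimono_inv_Suc card_image [OF inj] unfolding O
    by simp
qed

text \<open>The members of \<open>F\<close> inside \<open>D\<close> contribute one each, except for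
  the empty set, in total \<open>2 ^ d - card C - 1\<close>; \<open>block_excess\<close> supplies
  the rest. Subsets of \<open>D\<close> through \<open>v\<close> that are missing from
  \<open>F\<close> correspond to members of \<open>C\<close> avoiding \<open>v\<close>, which yields
  the required bound on \<open>t v\<close>.\<close>

lemma block_weight:
  assumes "D \<in> blocks"
  shows "real d * frakB d c \<le> (\<Sum>v\<in>D. weight F v)"
proof -
  obtain x where x: "closed x" "D = nbhd x" "x \<in> D" and D: "card D = d" "D \<subseteq> V" "finite D"
    using assms by (rule block_closed)
  let ?G = "{A \<in> F. A \<subseteq> D}"
  define C where "C = {S \<in> Pow D. D - S \<notin> F}"
  define t where "t v = card {A \<in> F. v \<in> A \<and> \<not> A \<subseteq> D}" for v
  have CD: "C \<subseteq> Pow D" by (auto simp: C_def)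
  have herC: "hereditary C"
    unfolding hereditary_def
  proof (intro allI impI)
    fix G H assume "G \<subseteq> H" "H \<in> C"
    moreover from this have "D - H \<subseteq> D - G" by blast
    ultimately show "G \<in> C" using her by (auto simp: C_def intro: hereditary_subset)
  qed
  have finC: "finite C" using CD D(3) by (auto intro: finite_subset)
  have inj: "inj_on ((-) D) (Pow D)" by (rule inj_onI) blast
  have card_missing: "card {S \<in> C. v \<notin> S} = card ({A \<in> Pow D. v \<in> A} - {A \<in> ?G. v \<in> A})" if "v \<in> D" for v
  proof -
    have img: "(-) D ` {S \<in> C. v \<notin> S} = {A \<in> Pow D. v \<in> A} - {A \<in> ?G. v \<in> A}"
    proof
      show "{A \<in> Pow D. v \<in> A} - {A \<in> ?G. v \<in> A} \<subseteq> (-) D ` {S \<in> C. v \<notin> S}"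
      proof
        fix A assume "A \<in> {A \<in> Pow D. v \<in> A} - {A \<in> ?G. v \<in> A}"
        then show "A \<in> (-) D ` {S \<in> C. v \<notin> S}"
          by (intro image_eqI [of _ _ "D - A"]) (auto simp: C_def double_diff)
      qed
    qed (use that in \<open>auto simp: C_def\<close>)
    have "inj_on ((-) D) {S \<in> C. v \<notin> S}" by (rule inj_on_subset [OF inj]) (use CD in auto)
    then show ?thesis unfolding img [symmetric] by (rule card_image [symmetric])
  qed
  have "real (card C) + (if c = d then 1 / 2 else 1) - real c \<le> (\<Sum>v\<in>D. colex_sum (inv_Suc \<circ> Suc) (t v))"
  proof (rule block_excess [OF d50 c D(3,1) CD herC _ x(3)])
    fix v assume v: "v \<in> D"
    have "card C = card {S \<in> C. v \<notin> S} + deg C v"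
      using card_split_link [OF finC] by (simp add: card_link)
    moreover have "card {S \<in> C. v \<notin> S} = 2 ^ (d - 1) - card {A \<in> ?G. v \<in> A}"
    proof -
      have "card ({A \<in> Pow D. v \<in> A} - {A \<in> ?G. v \<in> A}) = card {A \<in> Pow D. v \<in> A} - card {A \<in> ?G. v \<in> A}"
        using finF by (intro card_Diff_subset) auto
      then show ?thesis using card_missing [OF v] card_Pow_containing_point [OF v D(3)] D(1) by simp
    qed
    moreover have "card {A \<in> ?G. v \<in> A} \<le> 2 ^ (d - 1)"
    proof -
      have "card {A \<in> ?G. v \<in> A} \<le> card {A \<in> Pow D. v \<in> A}"
        using D(3) by (intro card_mono) auto
      then show ?thesis using card_Pow_containing_point [OF v D(3)] D(1) by simp
    qed
    moreover have "deg F v = card {A \<in> ?G. v \<in> A} + t v"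
    proof -
      have "{A \<in> F. v \<in> A} = {A \<in> ?G. v \<in> A} \<union> {A \<in> F. v \<in> A \<and> \<not> A \<subseteq> D}" by blast
      then show ?thesis unfolding deg_def t_def using finF by (subst card_Un_disjoint [symmetric]) auto
    qed
    moreover have "2 ^ (d - 1) + 1 \<le> deg F v + c" using v D(2) by (intro deg_ge) auto
    ultimately show "card C + 1 \<le> deg C v + t v + c" by linarith
  next
    have "{A \<in> F. x \<in> A \<and> \<not> A \<subseteq> D} = {}" using subset_nbhd [of _ x] x(2) by auto
    then show "t x = 0" unfolding t_def by (simp only: card.empty)
  qed
  moreover have "real (card (?G - {{}})) = 2 ^ d - real (card C) - 1"
  proof -
    have "(-) D ` C = Pow D - ?G"
    proof
      show "Pow D - ?G \<subseteq> (-) D ` C"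
      proof
        fix A assume "A \<in> Pow D - ?G"
        then show "A \<in> (-) D ` C" by (intro image_eqI [of _ _ "D - A"]) (auto simp: C_def double_diff)
      qed
    qed (auto simp: C_def)
    then have "card C = card (Pow D - ?G)"
      using card_image [OF inj_on_subset [OF inj CD]] by simp
    also have "\<dots> = 2 ^ d - card ?G"
      using finF D by (subst card_Diff_subset) (auto simp: card_Pow)
    finally have "card C = 2 ^ d - card ?G" .
    moreover have "card ?G \<le> 2 ^ d"
      using card_mono [of "Pow D" ?G] D by (auto simp: card_Pow)
    ultimately have "card C + card ?G = 2 ^ d" by linarith
    then have "real (card C) + real (card ?G) = 2 ^ d"
      by (metis of_nat_add of_nat_numeral of_nat_power)
    moreover have "{} \<in> ?G"
    proof -
      obtain A where "A \<in> F" using x(2,3) by (auto simp: nbhd_def)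
      then show ?thesis using her by (auto intro: hereditary_subset)
    qed
    then have "Suc (card (?G - {{}})) = card ?G" using finF by (intro card_Suc_Diff1) auto
    then have "real (card (?G - {{}})) + 1 = real (card ?G)" by linarith
    ultimately show ?thesis by linarith
  qed
  moreover have "(\<Sum>v\<in>D. \<Sum>A\<in>{A \<in> ?G. v \<in> A}. 1 / real (card A)) = real (card (?G - {{}}))"
    using finF D(3) by (intro sum_reciprocal_card) auto
  moreover have "(\<Sum>v\<in>D. (\<Sum>A\<in>{A \<in> ?G. v \<in> A}. 1 / real (card A)) + colex_sum (inv_Suc \<circ> Suc) (t v))
      \<le> (\<Sum>v\<in>D. weight F v)"
    unfolding t_def by (intro sum_mono weight_split)
  ultimately show ?thesis unfolding frakB_times sum.distrib by (simp split: if_splits)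
qed

section \<open>Vertices in several blocks and the sharing of excess weight\<close>

definition mult :: "'a \<Rightarrow> nat" where
  "mult v = card {D \<in> blocks. v \<in> D}"

text \<open>One block through \<open>y\<close> already gives \<open>y\<close> nearly the weight
  \<open>frakB d c\<close>. Each further block \<open>D\<close> adds the sets through
  \<open>y\<close> and a closed vertex \<open>w D\<close>: there are exponentially many, each of
  size at most \<open>d\<close>, and they are disjoint families for different blocks.\<close>

lemma shared_weight:
  assumes y: "2 \<le> mult y"
  shows "frakB d c + real (mult y) * (real d * real d) \<le> weight F y"
proof -
  define K where "K = {D \<in> blocks. y \<in> D}"
  have finK: "finite K" using finite_blocks by (simp add: K_def)
  have "\<forall>D\<in>blocks. \<exists>x. closed x \<and> D = nbhd x" by (auto simp: blocks_def)
  then obtain w where w: "\<And>D. D \<in> blocks \<Longrightarrow> closed (w D) \<and> D = nbhd (w D)" by metis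
  have wD: "w D \<in> D" if "D \<in> blocks" for D
    using w [OF that] self_in_nbhd [of "w D"] by (auto simp: closed_def)
  have same: "D = D'" if "D \<in> blocks" "D' \<in> blocks" "w D \<in> D'" for D D'
    using closed_nbhd_eq [of "w D'" "w D"] w [OF that(1)] w [OF that(2)] that(3) by auto
  \<comment> \<open>If \<open>y\<close> were such a closed vertex, \<open>same\<close> would make
    all blocks through \<open>y\<close> coincide.\<close>
  have y_w: "y \<noteq> w D" if "D \<in> K" for D
  proof
    assume "y = w D"
    then have "D' = D" if "D' \<in> K" for D'
      using same [of D D'] that \<open>D \<in> K\<close> by (auto simp: K_def)
    then have "K \<subseteq> {D}" by blast
    then have "card K \<le> 1" using card_mono [of "{D}" K] by simp
    then show False using y by (simp add: mult_def K_def)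
  qed
  define U where "U D = {A \<in> F. {w D, y} \<subseteq> A}" for D
  have U: "2 ^ (d - 2) < card (U D) + c" if "D \<in> K" for D
  proof -
    have "{w D, y} \<subseteq> nbhd (w D)" "closed (w D)" using that w [of D] wD [of D] by (auto simp: K_def)
    moreover have "card {w D, y} = 2" using y_w [OF that] by auto
    ultimately show ?thesis using closed_card_containing [of "w D" "{w D, y}"] by (simp add: U_def)
  qed
  have UD: "A \<subseteq> D" if "D \<in> K" "A \<in> U D" for A D
    using that w [of D] subset_nbhd [of A "w D"] by (auto simp: K_def U_def)
  have finU: "finite (U D)" for D using finF by (simp add: U_def)
  obtain D1 where D1: "D1 \<in> K" using y by (metis K_def card.empty ex_in_conv mult_def not_numeral_le_zero)
  let ?G = "{A \<in> F. A \<subseteq> D1}"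
  have G: "finite ?G" "hereditary ?G" using finF her by (auto simp: hereditary_def)
  have "frakB d c - 2 * real d \<le> weight ?G y"
  proof -
    \<comment> \<open>Deleting \<open>w D1\<close> from the members of \<open>U D1\<close> doubles
      their number and brings the degree of \<open>y\<close> inside \<open>D1\<close> close to
      \<open>2 ^ (d - 1)\<close>.\<close>
    have "card (U D1 \<union> (\<lambda>A. A - {w D1}) ` U D1) \<le> deg ?G y"
      unfolding deg_def using UD [OF D1] y_w [OF D1] her finF
      by (intro card_mono) (auto simp: U_def intro: hereditary_subset)
    moreover have "inj_on (\<lambda>A. A - {w D1}) (U D1)" by (rule inj_onI) (auto simp: U_def)
    then have "card (U D1 \<union> (\<lambda>A. A - {w D1}) ` U D1) = card (U D1) + card (U D1)"
      using finU [of D1] by (subst card_Un_disjoint) (auto simp: card_image U_def)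
    ultimately have "2 ^ (d - 1) \<le> deg ?G y + 2 * c" using U [OF D1] pow by linarith
    then have "colex_sum inv_Suc (2 ^ (d - 1)) \<le> colex_sum inv_Suc (deg ?G y + 2 * c)"
      by (intro colex_sum_mono) auto
    also have "\<dots> \<le> colex_sum inv_Suc (deg ?G y) + real (2 * c)"
      by (rule colex_sum_truncate) simp
    also have "colex_sum inv_Suc (deg ?G y) \<le> weight ?G y"
      unfolding weight_eq_sum_link [OF G] card_link [symmetric]
      by (intro hereditary_colex_bound finite_link [OF G(1)] hereditary_link [OF G(2)] antimono_inv_Suc)
    finally show ?thesis using frakB_le_cube c by simp
  qed
  moreover have "weight ?G y + (\<Sum>D\<in>K - {D1}. \<Sum>A\<in>U D. 1 / real (card A)) \<le> weight F y"
  proof -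
    have "(\<Sum>D\<in>K - {D1}. \<Sum>A\<in>U D. 1 / real (card A)) = (\<Sum>A\<in>\<Union>(U ` (K - {D1})). 1 / real (card A))"
    proof (rule sum.UNION_disjoint [symmetric])
      show "\<forall>D\<in>K - {D1}. \<forall>D'\<in>K - {D1}. D \<noteq> D' \<longrightarrow> U D \<inter> U D' = {}"
      proof (intro ballI impI)
        fix D D' assume D: "D \<in> K - {D1}" "D' \<in> K - {D1}" "D \<noteq> D'"
        have False if "A \<in> U D" "A \<in> U D'" for A
          using UD [of D' A] same [of D D'] that D by (auto simp: K_def U_def)
        then show "U D \<inter> U D' = {}" by blast
      qed
    qed (use finK finU in auto)
    moreover have "{A \<in> ?G. y \<in> A} \<inter> \<Union>(U ` (K - {D1})) = {}"
      using same [OF _ conjunct1 [OF D1 [unfolded K_def mem_Collect_eq]]] by (auto simp: K_def U_def)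
    then have "weight ?G y + (\<Sum>A\<in>\<Union>(U ` (K - {D1})). 1 / real (card A))
        = (\<Sum>A\<in>{A \<in> ?G. y \<in> A} \<union> \<Union>(U ` (K - {D1})). 1 / real (card A))"
      unfolding weight_def using finF finK finU by (intro sum.union_disjoint [symmetric]) auto
    moreover have "\<dots> \<le> weight F y"
      unfolding weight_def using finF by (intro sum_mono2) (auto simp: U_def)
    ultimately show ?thesis by linarith
  qed
  moreover have "(real (mult y) - 1) * (2 * (real d * real d) + 4 * real d)
      \<le> (\<Sum>D\<in>K - {D1}. \<Sum>A\<in>U D. 1 / real (card A))"
  proof -
    have "2 * (real d * real d) + 4 * real d \<le> (\<Sum>A\<in>U D. 1 / real (card A))" if D: "D \<in> K - {D1}" for D
    proof -
      have "2 * d ^ 3 + 3 * d ^ 2 \<le> (2::nat) ^ (d - 3)" by (rule cubic_le_power_two [OF d50])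
      then have "4 * d ^ 3 + 6 * d ^ 2 \<le> card (U D) + d" using U [of D] D pow(1) c by simp
      moreover have "d \<le> d ^ 2" "50 * d ^ 2 \<le> d ^ 3"
        using d50 by (simp_all add: power2_eq_square power3_eq_cube)
      ultimately have "2 * d ^ 3 + 4 * d ^ 2 \<le> card (U D)" by linarith
      then have "real (2 * d ^ 3 + 4 * d ^ 2) \<le> real (card (U D))" by (simp only: of_nat_le_iff)
      then have "2 * (real d * real d) + 4 * real d \<le> real (card (U D)) * (1 / real d)"
        using d50 by (simp add: field_simps power2_eq_square power3_eq_cube)
      also have "\<dots> \<le> (\<Sum>A\<in>U D. 1 / real (card A))"
      proof (rule sum_bounded_below)
        fix A assume A: "A \<in> U D"
        obtain x where D': "card D = d" "finite D" using D block_closed [of D] by (auto simp: K_def)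
        have "card A \<le> d" using card_mono [OF D'(2) UD [OF _ A]] D D'(1) by simp
        moreover have "0 < card A"
          using A UD [OF _ A] D D'(2) by (auto simp: U_def card_gt_0_iff intro: finite_subset)
        ultimately show "1 / real d \<le> 1 / real (card A)" by (intro divide_left_mono) auto
      qed
      finally show ?thesis .
    qed
    then have "real (card (K - {D1})) * (2 * (real d * real d) + 4 * real d)
        \<le> (\<Sum>D\<in>K - {D1}. \<Sum>A\<in>U D. 1 / real (card A))" by (rule sum_bounded_below)
    moreover have "real (card (K - {D1})) = real (mult y) - 1"
      using card_Suc_Diff1 [OF finK D1] by (simp add: mult_def K_def)
    ultimately show ?thesis by simp
  qed
  moreover have "real (mult y) * (real d * real d) + 2 * real d
      \<le> (real (mult y) - 1) * (2 * (real d * real d) + 4 * real d)"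
  proof -
    have "(real (mult y) / 2) * (2 * (real d * real d) + 4 * real d)
        \<le> (real (mult y) - 1) * (2 * (real d * real d) + 4 * real d)"
      using y by (intro mult_right_mono) auto
    moreover have "(real (mult y) / 2) * (2 * (real d * real d) + 4 * real d)
        = real (mult y) * (real d * real d) + 2 * (real (mult y) * real d)"
      by (simp add: field_simps)
    moreover have "1 * real d \<le> real (mult y) * real d" using y by (intro mult_right_mono) auto
    ultimately show ?thesis by linarith
  qed
  ultimately show ?thesis by linarith
qed

text \<open>Without shared vertices this is \<open>block_weight\<close>. Otherwise one shared vertex
  brings at least \<open>d * d\<close>, while each of the others loses at most
  \<open>d\<close>.\<close>

lemma block_share_nonneg:
  assumes "D \<in> blocks"
  shows "0 \<le> (\<Sum>v\<in>D. (weight F v - frakB d c) / real (mult v))"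
proof -
  obtain x where D: "card D = d" "D \<subseteq> V" "finite D"
    using assms by (rule block_closed)
  have pos: "1 \<le> mult v" if "v \<in> D" for v
  proof -
    have "{D \<in> blocks. v \<in> D} \<noteq> {}" using that assms by blast
    then show ?thesis using finite_blocks by (simp add: mult_def Suc_le_eq card_gt_0_iff)
  qed
  show ?thesis
  proof (cases "\<exists>y\<in>D. 2 \<le> mult y")
    case False
    have "mult v = 1" if "v \<in> D" for v
    proof -
      have "\<not> 2 \<le> mult v" using False that by blast
      then show ?thesis using pos [OF that] by linarith
    qed
    then have "(\<Sum>v\<in>D. (weight F v - frakB d c) / real (mult v)) = (\<Sum>v\<in>D. weight F v) - real d * frakB d c"
      using D(1) by (simp add: sum_subtractf)
    then show ?thesis using block_weight [OF assms] by simp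
  next
    case True
    then obtain y where y: "y \<in> D" "2 \<le> mult y" by blast
    have low: "- real d \<le> (weight F v - frakB d c) / real (mult v)" if "v \<in> D" for v
    proof -
      have "- real d \<le> weight F v - frakB d c" using weight_ge [of v] that D(2) by auto
      moreover have "- real d * real (mult v) \<le> - real d * 1"
        using pos [OF that] by (intro mult_left_mono_neg) auto
      ultimately show ?thesis using pos [OF that] by (simp add: pos_le_divide_eq)
    qed
    have "real d * real d \<le> (weight F y - frakB d c) / real (mult y)"
      using shared_weight [OF y(2)] y(2) by (simp add: pos_le_divide_eq algebra_simps)
    moreover have "real (card (D - {y})) * - real d
        \<le> (\<Sum>v\<in>D - {y}. (weight F v - frakB d c) / real (mult v))"
      using low by (intro sum_bounded_below) auto
    moreover have "real (card (D - {y})) * real d \<le> real d * real d"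
      using D card_Diff1_le [of D y] by (intro mult_right_mono) auto
    ultimately show ?thesis
      unfolding sum.remove [OF D(3) y(1)] by linarith
  qed
qed

lemma total_weight: "frakB d c * real (card V) \<le> (\<Sum>v\<in>V. weight F v)"
proof -
  let ?e = "\<lambda>v. weight F v - frakB d c"
  have "0 \<le> (\<Sum>D\<in>blocks. \<Sum>v\<in>D. ?e v / real (mult v))"
    by (intro sum_nonneg block_share_nonneg)
  also have "\<dots> = (\<Sum>D\<in>blocks. \<Sum>v\<in>V. if v \<in> D then ?e v / real (mult v) else 0)"
  proof (rule sum.cong [OF refl])
    fix D assume "D \<in> blocks"
    then have "V \<inter> D = D" using block_closed [of D] by blast
    then show "(\<Sum>v\<in>D. ?e v / real (mult v)) = (\<Sum>v\<in>V. if v \<in> D then ?e v / real (mult v) else 0)"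
      using finV by (simp add: sum.If_cases)
  qed
  also have "\<dots> = (\<Sum>v\<in>V. \<Sum>D\<in>blocks. if v \<in> D then ?e v / real (mult v) else 0)" by (rule sum.swap)
  also have "\<dots> = (\<Sum>v\<in>V. real (mult v) * (?e v / real (mult v)))"
    using finite_blocks by (simp add: sum.If_cases mult_def Int_def)
  also have "\<dots> \<le> (\<Sum>v\<in>V. ?e v)"
  proof (rule sum_mono)
    fix v assume v: "v \<in> V"
    show "real (mult v) * (?e v / real (mult v)) \<le> ?e v"
    \<comment> \<open>A closed vertex lies in its own block, so a vertex in no block has nonnegative
      excess by \<open>weight_not_closed\<close>.\<close>
    proof (cases "mult v = 0")
      case True
      then have "\<not> closed v" using finite_blocks self_in_nbhd [OF v] by (auto simp: mult_def blocks_def)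
      then show ?thesis using weight_not_closed [OF v] True by simp
    qed simp
  qed
  finally show ?thesis by (simp add: sum_subtractf mult.commute)
qed

end

theorem mainTheorem11:
  fixes n d c :: nat and F :: "nat set set"
  assumes "d \<ge> 50" and "1 \<le> c" and "c \<le> d"
    and "F \<subseteq> Pow {1..n}"
    and "hereditary F"
    and "real (min_deg F n) \<ge> 2 ^ (d - 1) - real c + 1"
  shows "(\<Sum>x\<in>{1..n}. weight F x) \<ge> frakB d c * real n"
proof -
  interpret dense_hereditary F "{1..n}" d c
  proof
    fix x assume "x \<in> {1..n}"
    then have "min_deg F n \<le> deg F x" unfolding min_deg_def by (intro Min_le) auto
    then have "2 ^ (d - 1) + 1 \<le> real (deg F x) + real c" using assms(6) by linarith
    then have "real (2 ^ (d - 1) + 1) \<le> real (deg F x + c)" by simp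
    then show "2 ^ (d - 1) + 1 \<le> deg F x + c" by (simp only: of_nat_le_iff)
  qed (use assms in auto)
  show ?thesis using total_weight by simp
qed

end
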